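(* In the RESTART model with task time distribution $F$ (density $f$), failure time distribution $G$ (density $g$) and total time $X$, assume that the support of $F$ has upper endpoint $0<t_0<\infty$, that $\overline G(t_0)>0$, and that $$f(t)\ \sim\ A\,(t_0-t)^\alpha,\qquad t\uparrow t_0,$$ for some $0<A<\infty$ and some $\alpha\ge0$. Let $\gamma(t_0)>0$ be the solution of $\int_0^{t_0}e^{\gamma(t_0)y}g(y)\,dy=1$ and let $B(t_0)=\int_0^{t_0}y\,e^{\gamma(t_0)y}g(y)\,dy$. Then, as $x\to\infty$, $$\overline H(x)\ \sim\ \frac{A\,B(t_0)^\alpha\,\overline G(t_0)\,\Gamma(\alpha+1)}{\gamma(t_0)\,e^{\alpha\gamma(t_0)t_0}\,g(t_0)^{\alpha+1}}\;\frac{e^{-\gamma(t_0)x}}{x^{\alpha+1}} .$$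
   Context: RESTART model: $T$ is a nonnegative random variable (task time) with distribution $F$ having density $f$. $U,U_1,U_2,\ldots$ are nonnegative i.i.d. random variables (failure times) with distribution $G$ having density $g$, independent of $T$. $N=\inf\{n\ge 0:\,U_{n+1}>T\}$, $S=\sum_{i=1}^N U_i$, and the total time is $X=T+S$, with distribution $H$. Write $\overline G(t)=\mathbb P(U>t)$ and $\overline H(x)=\mathbb P(X>x)$. It is assumed that $\mu=1/\mathbb E U>0$. $\Gamma$ is the Gamma function, and $a\sim b$ means that the ratio $a/b$ tends to $1$.
   Formalization: The density g is assumed to be left-continuous at t_0 with g(t_0)>0; otherwise g(t_0) could be changed at one point without changing G, making the claim false, or the right-hand side would be undefined. *)

theory Defs
  imports "HOL-Probability.Probability" "HOL-Library.Landau_Symbols" "HOL-Library.Extended_Nat"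
begin

text \<open>
  The primitive data of the RESTART model.  \<open>U 0\<close> plays the role of the generic failure time
  \<open>U\<close>, and \<open>U 1, U 2, \<dots>\<close> are the successive failure times.  Nonnegativity is only required almost
  surely.  The family \<open>case_nat T U\<close> lists \<open>T, U 0, U 1, \<dots>\<close>; its mutual independence says that the
  \<open>U i\<close> are independent and that \<open>T\<close> is independent of the whole sequence.
\<close>

locale restart_model = prob_space M
  for M :: "'a measure" +
  fixes T :: "'a \<Rightarrow> real" and U :: "nat \<Rightarrow> 'a \<Rightarrow> real"
    and f g :: "real \<Rightarrow> real"
  assumes f_nonneg: "0 \<le> f t"
    and g_nonneg: "0 \<le> g t"
    and T_distributed: "distributed M lborel T (\<lambda>t. ennreal (f t))"
    and U_distributed: "distributed M lborel (U i) (\<lambda>t. ennreal (g t))"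
    and T_nonneg: "AE \<omega> in M. 0 \<le> T \<omega>"
    and U_nonneg: "AE \<omega> in M. 0 \<le> U i \<omega>"
    and T_U_indep: "indep_vars (\<lambda>_. borel) (case_nat T U) UNIV"
    and U_integrable: "integrable M (U 0)"
    and mu_pos: "0 < 1 / expectation (U 0)"

text \<open>The infimum is taken in \<open>enat\<close>: \<open>N = \<infinity>\<close> if no failure time exceeds the task time.\<close>

definition restart_N :: "('a \<Rightarrow> real) \<Rightarrow> (nat \<Rightarrow> 'a \<Rightarrow> real) \<Rightarrow> 'a \<Rightarrow> enat" where
  "restart_N T U \<omega> = (INF n\<in>{n. U (n + 1) \<omega> > T \<omega>}. enat n)"

text \<open>Summand \<open>i\<close> of the series is \<open>U\<^sub>i\<^sub>+\<^sub>1\<close>, present exactly when \<open>i + 1 \<le> N\<close>.\<close>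

definition restart_S :: "('a \<Rightarrow> real) \<Rightarrow> (nat \<Rightarrow> 'a \<Rightarrow> real) \<Rightarrow> 'a \<Rightarrow> ennreal" where
  "restart_S T U \<omega> =
     (\<Sum>i. if enat (i + 1) \<le> restart_N T U \<omega> then ennreal (U (i + 1) \<omega>) else 0)"

definition restart_X :: "('a \<Rightarrow> real) \<Rightarrow> (nat \<Rightarrow> 'a \<Rightarrow> real) \<Rightarrow> 'a \<Rightarrow> ennreal" where
  "restart_X T U \<omega> = ennreal (T \<omega>) + restart_S T U \<omega>"

lemma restart_S_finite:
  assumes "restart_N T U \<omega> = enat n"
  shows "restart_S T U \<omega> = (\<Sum>i=1..n. ennreal (U i \<omega>))"
proof -
  have "restart_S T U \<omega> = (\<Sum>i<n. ennreal (U (i + 1) \<omega>))"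
    unfolding restart_S_def assms
    by (subst suminf_finite[of "{..<n}"]) auto
  also have "\<dots> = (\<Sum>i=1..n. ennreal (U i \<omega>))"
    by (rule sum.reindex_bij_witness[of _ "\<lambda>i. i - 1" "\<lambda>i. i + 1"]) auto
  finally show ?thesis .
qed

lemma restart_N_eq_enat_iff:
  "restart_N T U \<omega> = enat n \<longleftrightarrow> U (n + 1) \<omega> > T \<omega> \<and> (\<forall>k<n. U (k + 1) \<omega> \<le> T \<omega>)"
proof -
  let ?A = "{n. U (n + 1) \<omega> > T \<omega>}"
  show ?thesis
  proof
    assume N: "restart_N T U \<omega> = enat n"
    have "?A \<noteq> {}"
    proof
      assume "?A = {}"
      then show False
        using N unfolding restart_N_def by (simp only: image_empty Inf_empty top_enat_def) simp
    qed
    then obtain k where "enat k \<in> enat ` ?A"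
      by blast
    then have "restart_N T U \<omega> \<in> enat ` ?A"
      unfolding restart_N_def by (rule wellorder_InfI)
    moreover have "\<forall>k\<in>?A. restart_N T U \<omega> \<le> enat k"
      unfolding restart_N_def by (auto intro: INF_lower)
    ultimately show "U (n + 1) \<omega> > T \<omega> \<and> (\<forall>k<n. U (k + 1) \<omega> \<le> T \<omega>)"
      using N by (force simp: not_le[symmetric])
  next
    assume *: "U (n + 1) \<omega> > T \<omega> \<and> (\<forall>k<n. U (k + 1) \<omega> \<le> T \<omega>)"
    show "restart_N T U \<omega> = enat n"
      unfolding restart_N_def
    proof (rule antisym)
      show "(INF n\<in>?A. enat n) \<le> enat n"
        using * by (intro INF_lower) auto
      show "enat n \<le> (INF n\<in>?A. enat n)"
        using * by (intro INF_greatest) (metis mem_Collect_eq enat_ord_simps(1) not_le)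
    qed
  qed
qed

definition tail_prob :: "'a measure \<Rightarrow> ('a \<Rightarrow> 'b::ord) \<Rightarrow> 'b \<Rightarrow> real" where
  "tail_prob M Y x = measure M {\<omega> \<in> space M. x < Y \<omega>}"

definition measure_support :: "'a::topological_space measure \<Rightarrow> 'a set" where
  "measure_support \<mu> = {x. \<forall>V. open V \<longrightarrow> x \<in> V \<longrightarrow> emeasure \<mu> V > 0}"

text \<open>Taken in \<open>ereal\<close>, so that an unbounded or empty support cannot have a finite endpoint.\<close>

definition upper_endpoint :: "real measure \<Rightarrow> ereal" where
  "upper_endpoint \<mu> = (SUP x\<in>measure_support \<mu>. ereal x)"

end

theory Submission
  imports Defs "HOL-Real_Asymp.Real_Asymp"
begin

text \<open>
  Fix the task time \<open>t\<close> and let \<open>Z(u)\<close> be the probability that failures cost more than \<open>u\<close> before the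
  task succeeds.  The first failure time either exceeds \<open>t\<close>, and nothing is lost, or it is lost and
  everything starts afresh; hence \<open>Z(u) = \<integral>\<^sub>0\<^sup>t g(y) Z(u - y) dy\<close> for \<open>u \<ge> 0\<close>, with \<open>Z = 1\<close> on the
  negative half-line (\<open>lost_tail_renewal\<close>).  Let \<open>\<gamma>(t)\<close> be the exponent that turns \<open>e\<^bsup>\<gamma>(t) y\<^esup> g(y)\<close> into a
  probability density on \<open>[0, t]\<close>.  Then \<open>V(u) = e\<^bsup>\<gamma>(t) u\<^esup> Z(u)\<close> is at every \<open>u \<ge> 0\<close> an average of its own
  values on \<open>[u - t, u]\<close>, and it converges to a constant.  A conserved quantity, \<open>flow\<close>, identifies
  the constant as \<open>P(U > t) / (\<gamma>(t) B(t))\<close>, where \<open>B(t)\<close> is the mean of the tilted density.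

  This Cramer-Lundberg limit is needed uniformly for \<open>t\<close> near the endpoint \<open>t0\<close>.  Uniformity comes
  from a contraction estimate (\<open>deficit_contracts\<close>) whose constants involve the kernel only through a
  lower bound on a fixed interval.  If \<open>V \<le> M\<close>, the conserved quantity forces deficit \<open>M - V\<close>, in proportion to
  the gap between \<open>M\<close> and the limit, into every window of length \<open>t\<close>; the renewal equation smears this amount over
  longer and longer intervals, until the deficit is bounded below on a whole window and, by the
  maximum principle, for ever.  Applied to \<open>V\<close> and to \<open>-V\<close>, this gives geometric convergence.

  Near the endpoint the exponent is asymptotically linear.  Shortening the task from \<open>t0\<close> to \<open>t\<close> removes
  tilted mass of about \<open>(t0 - t) e\<^bsup>\<gamma> t0\<^esup> g(t0)\<close>, and increasing the exponent by \<open>\<eta>\<close> restores about \<open>\<eta> B(t0)\<close>,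
  so \<open>\<gamma>(t) - \<gamma>\<close> is asymptotic to \<open>c (t0 - t)\<close> with \<open>c = e\<^bsup>\<gamma> t0\<^esup> g(t0) / B(t0)\<close> (\<open>exponent_rate\<close>).

  The total time exceeds \<open>x\<close> with probability \<open>\<integral> f(t) Z(x - t) dt\<close> (\<open>total_time_tail\<close>; here \<open>Z\<close> depends
  on \<open>t\<close>).  Substituting \<open>t = t0 - v/x\<close> and multiplying by \<open>x\<^bsup>\<alpha>+1\<^esup> e\<^bsup>\<gamma> x\<^esup>\<close>, the integrand converges to
  \<open>A v\<^sup>\<alpha> C e\<^bsup>\<gamma> t0 - c v\<^esup>\<close> with \<open>C = P(U > t0) / (\<gamma> B(t0))\<close>.  Dominated convergence yields a Gamma integral,
  and task times that stay away from \<open>t0\<close> contribute exponentially less (\<open>total_time_limit\<close>).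
\<close>

section \<open>Renewal equations with a minorized kernel\<close>

text \<open>
  Comparison principle for a defective kernel: beyond \<open>x\<close> an upper bound \<open>s\<close> for \<open>E\<close> improves to \<open>q s\<close>,
  where \<open>q < 1\<close> is the mass of \<open>h\<close>, and iterating sends it to \<open>0\<close>.
\<close>

lemma subsolution_nonpos:
  fixes h E :: "real \<Rightarrow> real"
  assumes h_nonneg: "\<And>y. 0 \<le> h y"
    and h_integrable: "integrable lborel h"
    and h_supp: "\<And>y. y \<notin> {0..t} \<Longrightarrow> h y = 0"
    and h_mass: "(LINT y|lborel. h y) < 1"
    and start: "\<And>z. x - t \<le> z \<Longrightarrow> z < x \<Longrightarrow> E z \<le> 0"
    and bound: "\<And>z. x \<le> z \<Longrightarrow> E z \<le> s"
    and sub: "\<And>z. x \<le> z \<Longrightarrow> E z \<le> (LINT y|lborel. h y * E (z - y))"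
    and z: "x \<le> z"
  shows "E z \<le> 0"
proof -
  define q where "q = (LINT y|lborel. h y)"
  define s' where "s' = max s 0"
  have q0: "0 \<le> q" unfolding q_def by (intro Bochner_Integration.integral_nonneg) (use h_nonneg in auto)
  have iter: "E z \<le> q ^ n * s'" if "x - t \<le> z" for n z
    using that
  proof (induction n arbitrary: z)
    case 0
    then show ?case using start[of z] bound[of z] by (cases "z < x") (auto simp: s'_def)
  next
    case (Suc n)
    have pos: "0 \<le> q ^ Suc n * s'" using q0 by (auto simp: s'_def)
    show ?case
    proof (cases "z < x")
      case True
      then show ?thesis using start[OF Suc.prems] pos by linarith
    next
      case False
      have "(LINT y|lborel. h y * E (z - y)) \<le> q ^ Suc n * s'"
      \<comment> \<open>A divergent integral has the value 0 by convention, which also obeys the bound.\<close>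
      proof (cases "integrable lborel (\<lambda>y. h y * E (z - y))")
        case True
        have "(LINT y|lborel. h y * E (z - y)) \<le> (LINT y|lborel. h y * (q ^ n * s'))"
        proof (intro integral_mono True integrable_mult_left h_integrable)
          fix y
          show "h y * E (z - y) \<le> h y * (q ^ n * s')"
          proof (cases "y \<in> {0..t}")
            case True
            then show ?thesis using False by (intro mult_left_mono Suc.IH h_nonneg) auto
          qed (simp add: h_supp)
        qed
        also have "\<dots> = q ^ Suc n * s'"
          by (simp add: q_def)
        finally show ?thesis .
      qed (use pos in \<open>simp add: not_integrable_integral_eq\<close>)
      with sub[of z] False show ?thesis by linarith
    qed
  qed
  show ?thesis
  proof (cases "0 \<le> t")
    case True
    have "(\<lambda>n. q ^ n * s') \<longlonglongrightarrow> 0 * s'"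
      using q0 h_mass by (intro tendsto_mult LIMSEQ_realpow_zero tendsto_const) (auto simp: q_def)
    then show ?thesis
      using iter[of z] True z by (intro LIMSEQ_le_const[of _ 0]) auto
  next
    case False
    then have "h y = 0" for y using h_supp[of y] by auto
    then show ?thesis using sub[OF z] by simp
  qed
qed

text \<open>
  The windows are half-open so that adjacent ones add up exactly, without null sets.
\<close>

definition window_integral :: "(real \<Rightarrow> real) \<Rightarrow> real \<Rightarrow> real \<Rightarrow> real" where
  "window_integral V a b = (LINT y|lborel. (if a < y \<and> y \<le> b then V y else 0))"

lemma window_integrable:
  fixes V :: "real \<Rightarrow> real"
  assumes [measurable]: "V \<in> borel_measurable borel"
    and bd: "\<And>y. a < y \<Longrightarrow> y \<le> b \<Longrightarrow> \<bar>V y\<bar> \<le> K"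
  shows "integrable lborel (\<lambda>y. if a < y \<and> y \<le> b then V y else 0)"
proof (rule Bochner_Integration.integrable_bound)
  have fin: "emeasure lborel {a<..b} < \<infinity>" by (cases "a \<le> b") auto
  show "integrable lborel (\<lambda>y. indicator {a<..b} y * K)"
    by (intro integrable_mult_left integrable_real_indicator fin) auto
  show "AE y in lborel. norm (if a < y \<and> y \<le> b then V y else 0) \<le> norm (indicator {a<..b} y * K)"
    using bd by (intro AE_I2) (force simp: indicator_def)
qed measurable

lemma window_integral_nonneg:
  assumes "\<And>y. a < y \<Longrightarrow> y \<le> b \<Longrightarrow> 0 \<le> V y"
  shows "0 \<le> window_integral V a b"
  unfolding window_integral_def using assms by (intro Bochner_Integration.integral_nonneg) auto

lemma window_integral_const:
  assumes "a \<le> b"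
  shows "window_integral (\<lambda>_. c) a b = (b - a) * c"
proof -
  have "window_integral (\<lambda>_. c) a b = (LINT y|lborel. indicator {a<..b} y * c)"
    unfolding window_integral_def by (intro Bochner_Integration.integral_cong) (auto simp: indicator_def)
  then show ?thesis using assms by simp
qed

lemma window_integral_add:
  assumes [measurable]: "V \<in> borel_measurable borel"
    and bd: "\<And>y. a < y \<Longrightarrow> y \<le> c \<Longrightarrow> \<bar>V y\<bar> \<le> K" and "a \<le> b" "b \<le> c"
  shows "window_integral V a c = window_integral V a b + window_integral V b c"
proof -
  have "window_integral V a b + window_integral V b c =
    (LINT y|lborel. (if a < y \<and> y \<le> b then V y else 0) + (if b < y \<and> y \<le> c then V y else 0))"
    unfolding window_integral_def
    by (intro Bochner_Integration.integral_add[symmetric] window_integrable[where K = K])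
      (use assms in auto)
  also have "\<dots> = window_integral V a c"
    unfolding window_integral_def
    by (intro Bochner_Integration.integral_cong) (use assms in auto)
  finally show ?thesis by simp
qed

lemma window_integral_subset:
  assumes [measurable]: "V \<in> borel_measurable borel"
    and bd: "\<And>y. a < y \<Longrightarrow> y \<le> b \<Longrightarrow> 0 \<le> V y \<and> V y \<le> K" and "a \<le> a'" "b' \<le> b"
  shows "window_integral V a' b' \<le> window_integral V a b"
  unfolding window_integral_def
proof (intro integral_mono window_integrable[where K = K])
  show "(if a' < y \<and> y \<le> b' then V y else 0) \<le> (if a < y \<and> y \<le> b then V y else 0)" for y
    using bd[of y] assms(3,4) by auto
  show "\<bar>V y\<bar> \<le> K" if "a' < y" "y \<le> b'" for y
    using that bd[of y] assms(3,4) by auto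
  show "\<bar>V y\<bar> \<le> K" if "a < y" "y \<le> b" for y
    using that bd[of y] by auto
qed auto

lemma window_integral_mono:
  assumes [measurable]: "V \<in> borel_measurable borel" "W \<in> borel_measurable borel"
    and bd: "\<And>y. a < y \<Longrightarrow> y \<le> b \<Longrightarrow> \<bar>V y\<bar> \<le> K \<and> \<bar>W y\<bar> \<le> K"
    and le: "\<And>y. a < y \<Longrightarrow> y \<le> b \<Longrightarrow> V y \<le> W y"
  shows "window_integral V a b \<le> window_integral W a b"
  unfolding window_integral_def
  by (intro integral_mono window_integrable[where K = K]) (use bd le in auto)

lemma window_integral_const_minus:
  assumes [measurable]: "V \<in> borel_measurable borel"
    and bd: "\<And>y. a < y \<Longrightarrow> y \<le> b \<Longrightarrow> \<bar>V y\<bar> \<le> K" and "a \<le> b"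
  shows "window_integral (\<lambda>y. c - V y) a b = (b - a) * c - window_integral V a b"
proof -
  have "window_integral (\<lambda>y. c - V y) a b =
    (LINT y|lborel. (if a < y \<and> y \<le> b then c else 0) - (if a < y \<and> y \<le> b then V y else 0))"
    unfolding window_integral_def by (intro Bochner_Integration.integral_cong) auto
  also have "\<dots> = window_integral (\<lambda>_. c) a b - window_integral V a b"
    unfolding window_integral_def
    by (intro Bochner_Integration.integral_diff window_integrable[where K = K]
        window_integrable[where K = "\<bar>c\<bar>"]) (use assms in auto)
  finally show ?thesis using assms(3) by (simp add: window_integral_const)
qed

lemma window_integral_shift:
  "window_integral V (a - u) (b - u) = window_integral (\<lambda>z. V (z - u)) a b"
  unfolding window_integral_def
  by (subst lborel_integral_real_affine[where c = 1 and t = "- u"])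
    (auto intro!: Bochner_Integration.integral_cong simp: algebra_simps)

lemma window_integral_reflect:
  "window_integral V (z - b) (z - a) = (LINT y|lborel. (if a \<le> y \<and> y < b then V (z - y) else 0))"
  unfolding window_integral_def
  by (subst lborel_integral_real_affine[where c = "-1" and t = z])
    (auto intro!: Bochner_Integration.integral_cong simp: algebra_simps)

lemma window_pigeonhole:
  fixes n :: nat and x l :: real and D :: "real \<Rightarrow> real"
  assumes [measurable]: "D \<in> borel_measurable borel" and n: "0 < n" and l: "0 \<le> l"
    and D: "\<And>y. x < y \<Longrightarrow> y \<le> x + n * l \<Longrightarrow> \<bar>D y\<bar> \<le> K"
    and mass: "m \<le> window_integral D x (x + n * l)"
  obtains j where "j < n" "m / n \<le> window_integral D (x + j * l) (x + j * l + l)"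
proof -
  have split: "window_integral D x (x + i * l) = (\<Sum>j<i. window_integral D (x + j * l) (x + j * l + l))"
    if "i \<le> n" for i :: nat
    using that
  proof (induction i)
    case 0
    have "window_integral D x x = (LINT y::real|lborel. (0::real))"
      unfolding window_integral_def by (intro Bochner_Integration.integral_cong) auto
    then show ?case by simp
  next
    case (Suc i)
    have le: "x + Suc i * l \<le> x + n * l"
      using Suc.prems l by (auto intro: mult_right_mono)
    have "window_integral D x (x + Suc i * l) = window_integral D x (x + i * l) +
        window_integral D (x + i * l) (x + Suc i * l)"
    proof (rule window_integral_add[where K = K])
      show "x + real i * l \<le> x + real (Suc i) * l" using l by (auto intro: mult_right_mono)
      show "\<bar>D y\<bar> \<le> K" if "x < y" "y \<le> x + real (Suc i) * l" for y
        using that le by (intro D) auto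
    qed (use l in auto)
    moreover have "x + Suc i * l = x + i * l + l" by (simp add: algebra_simps)
    ultimately have "window_integral D x (x + Suc i * l) =
        window_integral D x (x + i * l) + window_integral D (x + i * l) (x + i * l + l)"
      by metis
    then show ?case using Suc by simp
  qed
  have "\<exists>j<n. m / n \<le> window_integral D (x + j * l) (x + j * l + l)"
  proof (rule ccontr)
    assume "\<not> ?thesis"
    then have "window_integral D (x + j * l) (x + j * l + l) < m / n" if "j < n" for j
      using that by force
    then have "(\<Sum>j<n. window_integral D (x + j * l) (x + j * l + l)) < (\<Sum>j<n. m / n)"
      using n by (intro sum_strict_mono) auto
    also have "\<dots> = m" using n by simp
    finally show False using mass split[of n] by simp
  qed
  then show thesis using that by blast
qed

text \<open>
  A probability density on \<open>[0, t]\<close> that an exponential weight makes defective.  The weight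
  \<open>e\<^bsup>-\<gamma> y\<^esup>\<close> undoes the tilting, and the defect is the chance that no further failure occurs.
\<close>

locale renewal_kernel =
  fixes k :: "real \<Rightarrow> real" and t \<gamma> :: real
  assumes k_nonneg: "0 \<le> k y"
    and k_integrable: "integrable lborel k"
    and k_supp: "y \<notin> {0..t} \<Longrightarrow> k y = 0"
    and k_mass: "(LINT y|lborel. k y) = 1"
    and k_defect: "(LINT y|lborel. k y * exp (- \<gamma> * y)) < 1"
    and \<gamma>_pos: "0 < \<gamma>"
    and t_pos: "0 < t"
begin

text \<open>
  The growth bound makes solutions bounded on every left half-line, which is all that the
  renewal integral sees.
\<close>

definition solution :: "(real \<Rightarrow> real) \<Rightarrow> bool" where
  "solution V \<longleftrightarrow> V \<in> borel_measurable borel \<and> (\<exists>s\<ge>0. \<forall>z. \<bar>V z\<bar> \<le> s * exp (\<gamma> * z)) \<and>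
     (\<forall>z\<ge>0. V z = (LINT y|lborel. k y * V (z - y)))"

text \<open>
  For a renewal process with interarrival density \<open>k\<close>, \<open>flow V x\<close> is the integral of \<open>V\<close> against the
  stationary age profile \<open>y \<mapsto> \<integral>\<^sub>y\<^sup>\<infinity> k\<close>, seen from \<open>x\<close>; for constant \<open>V\<close> it equals \<open>V\<close> times the mean of \<open>k\<close>.
\<close>

definition flow :: "(real \<Rightarrow> real) \<Rightarrow> real \<Rightarrow> real" where
  "flow V x = (LINT u|lborel. k u * window_integral V (x - u) x)"

definition mean :: real where
  "mean = (LINT u|lborel. k u * u)"

lemma k_measurable [measurable]: "k \<in> borel_measurable borel"
  using k_integrable by auto

lemma k_weighted_integrable:
  assumes [measurable]: "w \<in> borel_measurable borel"
    and "\<And>y. 0 \<le> y \<Longrightarrow> y \<le> t \<Longrightarrow> \<bar>w y\<bar> \<le> K"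
  shows "integrable lborel (\<lambda>y. k y * w y)"
proof (rule Bochner_Integration.integrable_bound)
  show "integrable lborel (\<lambda>y. k y * K)"
    by (intro integrable_mult_left k_integrable)
  show "AE y in lborel. norm (k y * w y) \<le> norm (k y * K)"
  proof (rule AE_I2)
    fix y
    show "norm (k y * w y) \<le> norm (k y * K)"
    proof (cases "y \<in> {0..t}")
      case True
      then have "\<bar>w y\<bar> \<le> \<bar>K\<bar>" using assms(2)[of y] by auto
      then show ?thesis using k_nonneg[of y] by (auto simp: abs_mult intro!: mult_left_mono)
    qed (simp add: k_supp)
  qed
qed measurable

lemma solution_measurable: "solution V \<Longrightarrow> V \<in> borel_measurable borel"
  by (simp add: solution_def)

lemma solution_eq: "solution V \<Longrightarrow> 0 \<le> z \<Longrightarrow> V z = (LINT y|lborel. k y * V (z - y))"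
  by (simp add: solution_def)

lemma solution_locally_bounded:
  assumes "solution V"
  obtains K where "0 \<le> K" "\<And>y. y \<le> z \<Longrightarrow> \<bar>V y\<bar> \<le> K"
proof -
  from assms obtain s where s: "s \<ge> 0" "\<And>z. \<bar>V z\<bar> \<le> s * exp (\<gamma> * z)"
    by (auto simp: solution_def)
  have "\<bar>V y\<bar> \<le> s * exp (\<gamma> * z)" if "y \<le> z" for y
  proof -
    have "s * exp (\<gamma> * y) \<le> s * exp (\<gamma> * z)"
      using s(1) that \<gamma>_pos by (intro mult_left_mono) auto
    with s(2)[of y] show ?thesis by linarith
  qed
  moreover have "0 \<le> s * exp (\<gamma> * z)" using s(1) by simp
  ultimately show ?thesis using that by blast
qed

lemma solution_uminus: "solution V \<Longrightarrow> solution (\<lambda>z. - V z)"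
  by (auto simp: solution_def)

lemma solution_integrable:
  assumes "solution V"
  shows "integrable lborel (\<lambda>y. k y * V (z - y))"
proof -
  have [measurable]: "V \<in> borel_measurable borel" by (rule solution_measurable[OF assms])
  obtain K where K: "\<And>y. y \<le> z \<Longrightarrow> \<bar>V y\<bar> \<le> K"
    using solution_locally_bounded[OF assms, of z] by blast
  show ?thesis by (rule k_weighted_integrable[where K = K]) (auto intro: K)
qed

lemma solution_const_minus:
  assumes "solution V" "0 \<le> z"
  shows "M - V z = (LINT y|lborel. k y * (M - V (z - y)))"
  using solution_integrable[OF assms(1), of z] k_integrable
  by (simp add: right_diff_distrib k_mass solution_eq[OF assms, symmetric])

text \<open>
  A probability kernel alone gives no contraction, since its mass may sit near \<open>0\<close>.  Multiplying
  \<open>V - M\<close> by \<open>e\<^bsup>-\<gamma> z\<^esup>\<close> turns it into a solution for the defective kernel, to which comparison applies.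
\<close>

lemma maximum_principle:
  assumes V: "solution V" and "0 \<le> x"
    and start: "\<And>z. x - t \<le> z \<Longrightarrow> z < x \<Longrightarrow> V z \<le> M"
    and z: "x \<le> z"
  shows "V z \<le> M"
proof -
  from V obtain s where s: "s \<ge> 0" "\<And>z. \<bar>V z\<bar> \<le> s * exp (\<gamma> * z)"
    by (auto simp: solution_def)
  define E where "E z = exp (- \<gamma> * z) * (V z - M)" for z
  have "E z \<le> 0"
  proof (rule subsolution_nonpos[where h = "\<lambda>y. k y * exp (- \<gamma> * y)" and E = E and z = z and t = t and x = x and s = "s + \<bar>M\<bar>"])
    show "integrable lborel (\<lambda>y. k y * exp (- \<gamma> * y))"
      by (rule k_weighted_integrable[where K = 1]) (use \<gamma>_pos in \<open>auto simp: mult_nonneg_nonneg\<close>)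
    show "E z \<le> s + \<bar>M\<bar>" if "x \<le> z" for z
    proof -
      have "exp (- \<gamma> * z) * V z \<le> exp (- \<gamma> * z) * (s * exp (\<gamma> * z))"
        using s(2)[of z] by (intro mult_left_mono) auto
      also have "\<dots> = s" by (simp add: exp_minus field_simps)
      finally have 1: "exp (- \<gamma> * z) * V z \<le> s" .
      have "exp (- \<gamma> * z) * (- M) \<le> exp (- \<gamma> * z) * \<bar>M\<bar>"
        by (intro mult_left_mono) auto
      also have "\<dots> \<le> 1 * \<bar>M\<bar>"
        using that assms(2) \<gamma>_pos by (intro mult_right_mono) auto
      finally show ?thesis using 1 by (simp add: E_def algebra_simps)
    qed
    show "E z \<le> (LINT y|lborel. k y * exp (- \<gamma> * y) * E (z - y))" if "x \<le> z" for z
    proof -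
      have "(LINT y|lborel. k y * exp (- \<gamma> * y) * E (z - y)) =
        (LINT y|lborel. - exp (- \<gamma> * z) * (k y * (M - V (z - y))))"
      proof (intro Bochner_Integration.integral_cong refl)
        fix y
        have "exp (- \<gamma> * z) = exp (- \<gamma> * y) * exp (- \<gamma> * (z - y))"
          by (simp add: exp_add[symmetric] algebra_simps)
        then show "k y * exp (- \<gamma> * y) * E (z - y) = - exp (- \<gamma> * z) * (k y * (M - V (z - y)))"
          unfolding E_def by (simp only:) (simp only: algebra_simps)
      qed
      also have "\<dots> = - exp (- \<gamma> * z) * (M - V z)"
        using that assms(2) by (simp add: solution_const_minus[OF V])
      finally show ?thesis by (simp add: E_def algebra_simps)
    qed
    show "E z \<le> 0" if "x - t \<le> z" "z < x" for z
      using start[OF that] by (auto simp: E_def mult_le_0_iff)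
  qed (use k_nonneg k_supp k_defect z in auto)
  then show ?thesis by (simp add: E_def mult_le_0_iff)
qed

lemma flow_integrable:
  assumes V: "solution V"
  shows "integrable lborel (\<lambda>u. k u * window_integral V (x - u) x)"
proof -
  have [measurable]: "V \<in> borel_measurable borel" by (rule solution_measurable[OF V])
  obtain K where K: "0 \<le> K" "\<And>y. y \<le> x \<Longrightarrow> \<bar>V y\<bar> \<le> K"
    using solution_locally_bounded[OF V, of x] by blast
  have [measurable]: "(\<lambda>u. window_integral V (x - u) x) \<in> borel_measurable borel"
    unfolding window_integral_def by measurable
  show ?thesis
  proof (rule k_weighted_integrable[where K = "t * K"])
    fix u assume u: "0 \<le> u" "u \<le> t"
    have "\<bar>window_integral V (x - u) x\<bar> \<le> u * K"
    proof -
      have "window_integral V (x - u) x \<le> window_integral (\<lambda>_. K) (x - u) x"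
        by (rule window_integral_mono[where K = K]) (use K in \<open>auto simp: abs_le_iff\<close>)
      moreover have "window_integral (\<lambda>_. - K) (x - u) x \<le> window_integral V (x - u) x"
        by (rule window_integral_mono[where K = K]) (use K in \<open>auto simp: abs_le_iff minus_le_iff\<close>)
      ultimately show ?thesis using u by (auto simp: window_integral_const)
    qed
    also have "\<dots> \<le> t * K" using u K by (intro mult_right_mono) auto
    finally show "\<bar>window_integral V (x - u) x\<bar> \<le> t * K" .
  qed measurable
qed

text \<open>
  Moving the window from \<open>(-u, 0]\<close> to \<open>(x - u, x]\<close> changes the integral of \<open>V\<close> by
  \<open>\<integral>\<^sub>0\<^sup>x (V(z) - V(z - u)) dz\<close>.  Averaged over \<open>u\<close> against \<open>k\<close>, this vanishes by the renewal equation.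
\<close>

lemma flow_conserved:
  assumes V: "solution V" and x: "0 \<le> x"
  shows "flow V x = flow V 0"
proof -
  have [measurable]: "V \<in> borel_measurable borel" by (rule solution_measurable[OF V])
  obtain K where K: "0 \<le> K" "\<And>y. y \<le> x \<Longrightarrow> \<bar>V y\<bar> \<le> K"
    using solution_locally_bounded[OF V, of x] by blast
  define c where "c = window_integral V 0 x"
  let ?f = "\<lambda>u z. k u * (if 0 < z \<and> z \<le> x then V (z - u) else 0)"
  have int2: "integrable (lborel \<Otimes>\<^sub>M lborel) (\<lambda>(u, z). ?f u z)"
  proof (rule Bochner_Integration.integrable_bound)
    let ?g = "\<lambda>(u, z). k u * (indicator {0<..x} z * K)"
    show "integrable (lborel \<Otimes>\<^sub>M lborel) ?g"
    proof (rule lborel_pair.Fubini_integrable)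
      have "(\<lambda>u. LINT z|lborel. norm (?g (u, z))) = (\<lambda>u. k u * (x * K))"
        using K(1) x k_nonneg by (auto simp: abs_mult)
      then show "integrable lborel (\<lambda>u. LINT z|lborel. norm (?g (u, z)))"
        using k_integrable by simp
      show "AE u in lborel. integrable lborel (\<lambda>z. ?g (u, z))"
        by (auto intro!: AE_I2 integrable_mult_right integrable_mult_left integrable_real_indicator
          emeasure_bounded_finite)
    qed measurable
    show "AE p in lborel \<Otimes>\<^sub>M lborel. norm ((\<lambda>(u, z). ?f u z) p) \<le> norm (?g p)"
    proof (rule AE_I2, clarsimp simp: abs_mult indicator_def, goal_cases)
      case (1 u z)
      show ?case
      proof (cases "u \<in> {0..t}")
        case True
        then have "\<bar>V (z - u)\<bar> \<le> \<bar>K\<bar>" using K(2)[of "z - u"] 1 K(1) by auto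
        then show ?thesis by (intro mult_left_mono) auto
      qed (simp add: k_supp)
    qed
  qed measurable
  have inner: "k u * window_integral V (x - u) x - k u * window_integral V (0 - u) 0
      = k u * c - (LINT z|lborel. ?f u z)" for u
  proof (cases "u \<in> {0..t}")
    case True
    have "window_integral V (- u) x = window_integral V (- u) (x - u) + window_integral V (x - u) x"
      by (rule window_integral_add[where K = K]) (use K x True in auto)
    moreover have "window_integral V (- u) x = window_integral V (- u) 0 + window_integral V 0 x"
      by (rule window_integral_add[where K = K]) (use K x True in auto)
    moreover have "window_integral V (0 - u) (x - u) = window_integral (\<lambda>z. V (z - u)) 0 x"
      by (rule window_integral_shift)
    ultimately have "window_integral V (x - u) x - window_integral V (0 - u) 0
      = c - window_integral (\<lambda>z. V (z - u)) 0 x"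
      by (simp add: c_def)
    then show ?thesis
      by (simp add: window_integral_def right_diff_distrib[symmetric])
  qed (simp add: k_supp)
  have "flow V x - flow V 0 =
    (LINT u|lborel. k u * window_integral V (x - u) x - k u * window_integral V (0 - u) 0)"
    unfolding flow_def
    by (intro Bochner_Integration.integral_diff[symmetric] flow_integrable V)
  also have "\<dots> = (LINT u|lborel. k u * c - (LINT z|lborel. ?f u z))"
    unfolding inner ..
  also have "\<dots> = (LINT u|lborel. k u * c) - (LINT u|lborel. (LINT z|lborel. ?f u z))"
  proof (rule Bochner_Integration.integral_diff)
    show "integrable lborel (\<lambda>u. LINT z|lborel. ?f u z)"
      using lborel_pair.integrable_fst'[OF int2] by simp
  qed (use k_integrable in auto)
  also have "(LINT u|lborel. (LINT z|lborel. ?f u z)) = (LINT z|lborel. (LINT u|lborel. ?f u z))"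
    using lborel_pair.Fubini_integral[OF int2] by simp
  also have "\<dots> = (LINT z|lborel. (if 0 < z \<and> z \<le> x then V z else 0))"
    by (intro Bochner_Integration.integral_cong) (auto simp: solution_eq[OF V, symmetric])
  also have "(LINT u|lborel. k u * c) = c" by (simp add: k_mass)
  finally show ?thesis by (simp add: c_def window_integral_def)
qed

text \<open>
  The flow of the constant \<open>M\<close> is \<open>M * mean\<close>, so the flow of the deficit \<open>M - V\<close> is the same at all times.
  It is at most the integral of the deficit over the last \<open>t\<close> time units, because every inner window
  in the definition of the flow lies in that one.
\<close>

lemma deficit_mass:
  assumes V: "solution V" and x: "0 \<le> x"
    and M: "\<And>z. x - t \<le> z \<Longrightarrow> z \<le> x \<Longrightarrow> V z \<le> M"
  shows "M * mean - flow V 0 \<le> window_integral (\<lambda>z. M - V z) (x - t) x"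
    and "0 \<le> M * mean - flow V 0"
proof -
  have [measurable]: "V \<in> borel_measurable borel" by (rule solution_measurable[OF V])
  obtain K where K: "0 \<le> K" "\<And>y. y \<le> x \<Longrightarrow> \<bar>V y\<bar> \<le> K"
    using solution_locally_bounded[OF V, of x] by blast
  let ?D = "window_integral (\<lambda>z. M - V z)"
  have ku: "integrable lborel (\<lambda>u. k u * (M * u))"
    by (rule k_weighted_integrable[where K = "\<bar>M\<bar> * t"]) (auto simp: abs_mult intro!: mult_left_mono)
  have inner: "k u * (M * u) - k u * window_integral V (x - u) x = k u * ?D (x - u) x" for u
  proof (cases "u \<in> {0..t}")
    case True
    then have "?D (x - u) x = (x - (x - u)) * M - window_integral V (x - u) x"
      by (intro window_integral_const_minus[where K = K]) (use K in auto)
    then have "?D (x - u) x = M * u - window_integral V (x - u) x" by simp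
    then show ?thesis by (simp only: right_diff_distrib)
  qed (simp add: k_supp)
  have Mm: "M * mean = (LINT u|lborel. k u * (M * u))"
    unfolding mean_def integral_mult_right_zero[symmetric]
    by (intro Bochner_Integration.integral_cong) auto
  have "M * mean - flow V 0 = (LINT u|lborel. k u * (M * u)) - flow V x"
    using flow_conserved[OF V x] Mm by simp
  also have "\<dots> = (LINT u|lborel. k u * (M * u) - k u * window_integral V (x - u) x)"
    unfolding flow_def by (intro Bochner_Integration.integral_diff[symmetric] flow_integrable V ku)
  also have "\<dots> = (LINT u|lborel. k u * ?D (x - u) x)"
    unfolding inner ..
  finally have eq: "M * mean - flow V 0 = (LINT u|lborel. k u * ?D (x - u) x)" .
  have nonneg: "0 \<le> k u * ?D (x - u) x" for u
  proof (cases "u \<in> {0..t}")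
    case True
    then show ?thesis
      by (intro mult_nonneg_nonneg k_nonneg window_integral_nonneg) (auto intro: M)
  qed (simp add: k_supp)
  show "0 \<le> M * mean - flow V 0"
    unfolding eq by (intro Bochner_Integration.integral_nonneg nonneg)
  have "(LINT u|lborel. k u * ?D (x - u) x) \<le> (LINT u|lborel. k u * ?D (x - t) x)"
  proof (rule integral_mono)
    show "integrable lborel (\<lambda>u. k u * ?D (x - u) x)"
      unfolding inner[symmetric]
      by (intro Bochner_Integration.integrable_diff flow_integrable V ku)
    show "integrable lborel (\<lambda>u. k u * ?D (x - t) x)"
      by (intro integrable_mult_left k_integrable)
    show "k u * ?D (x - u) x \<le> k u * ?D (x - t) x" for u
    proof (cases "u \<in> {0..t}")
      case True
      show ?thesis
      proof (intro mult_left_mono k_nonneg window_integral_subset[where K = "\<bar>M\<bar> + K"])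
        show "0 \<le> M - V y \<and> M - V y \<le> \<bar>M\<bar> + K" if "x - t < y" "y \<le> x" for y
          using that K(2)[of y] M[of y] by auto
      qed (use True in auto)
    qed (simp add: k_supp)
  qed
  then show "M * mean - flow V 0 \<le> ?D (x - t) x"
    unfolding eq by (simp add: k_mass)
qed

end

text \<open>
  All rates of convergence below depend on the kernel only through \<open>a\<close>, \<open>b\<close>, \<open>\<kappa>\<close> and an upper bound for \<open>t\<close>;
  the mean, which also enters, is bounded below in terms of \<open>a\<close>, \<open>b\<close> and \<open>\<kappa>\<close>.
\<close>

locale minorized_renewal_kernel = renewal_kernel +
  fixes a b \<kappa> :: real
  assumes a_pos: "0 < a" and a_less_b: "a < b" and b_le: "b \<le> t"
    and \<kappa>_pos: "0 < \<kappa>"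
    and minorization: "a \<le> y \<Longrightarrow> y \<le> b \<Longrightarrow> \<kappa> \<le> k y"
begin

lemma deficit_spreads:
  assumes V: "solution V" and x: "0 \<le> x"
    and M: "\<And>z. x - t \<le> z \<Longrightarrow> V z \<le> M"
    and z: "x \<le> z"
  shows "\<kappa> * window_integral (\<lambda>y. M - V y) (z - b) (z - a) \<le> M - V z"
proof -
  have [measurable]: "V \<in> borel_measurable borel" by (rule solution_measurable[OF V])
  obtain K where K: "0 \<le> K" "\<And>y. y \<le> z \<Longrightarrow> \<bar>V y\<bar> \<le> K"
    using solution_locally_bounded[OF V, of z] by blast
  have "\<kappa> * window_integral (\<lambda>y. M - V y) (z - b) (z - a)
    = (LINT y|lborel. \<kappa> * (if a \<le> y \<and> y < b then M - V (z - y) else 0))"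
    by (simp only: window_integral_reflect integral_mult_right_zero)
  also have "\<dots> \<le> (LINT y|lborel. k y * (M - V (z - y)))"
  proof (rule integral_mono)
    show "integrable lborel (\<lambda>y. k y * (M - V (z - y)))"
    proof (rule k_weighted_integrable[where K = "\<bar>M\<bar> + K"])
      show "\<bar>M - V (z - y)\<bar> \<le> \<bar>M\<bar> + K" if "0 \<le> y" for y
        using K(2)[of "z - y"] that by linarith
    qed measurable
    show "integrable lborel (\<lambda>y. \<kappa> * (if a \<le> y \<and> y < b then M - V (z - y) else 0))"
    proof (rule integrable_mult_right, rule Bochner_Integration.integrable_bound)
      show "integrable lborel (\<lambda>y. indicator {a..<b} y * (\<bar>M\<bar> + K))"
        by (intro integrable_mult_left integrable_real_indicator) (use a_less_b in auto)
      show "AE y in lborel. norm (if a \<le> y \<and> y < b then M - V (z - y) else 0)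
          \<le> norm (indicator {a..<b} y * (\<bar>M\<bar> + K))"
      proof (rule AE_I2)
        fix y
        show "norm (if a \<le> y \<and> y < b then M - V (z - y) else 0)
          \<le> norm (indicator {a..<b} y * (\<bar>M\<bar> + K))"
        proof (cases "a \<le> y \<and> y < b")
          case True
          then have "\<bar>M - V (z - y)\<bar> \<le> \<bar>M\<bar> + K" using K(2)[of "z - y"] a_pos by linarith
          then show ?thesis using True K(1) by simp
        qed auto
      qed
    qed measurable
    show "\<kappa> * (if a \<le> y \<and> y < b then M - V (z - y) else 0) \<le> k y * (M - V (z - y))" for y
    proof (cases "y \<in> {0..t}")
      case True
      then have "0 \<le> M - V (z - y)" using M[of "z - y"] z by auto
      then show ?thesis
        using mult_right_mono[OF minorization[of y], of "M - V (z - y)"] k_nonneg[of y] by auto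
    next
      case False
      then show ?thesis using a_pos b_le by (auto simp: k_supp)
    qed
  qed
  also have "\<dots> = M - V z"
    using x z by (intro solution_const_minus[OF V, symmetric]) auto
  finally show ?thesis .
qed

text \<open>
  Deficit of mass \<open>m\<close> in a window of half the length \<open>l\<close> forces a pointwise deficit on an interval of
  length \<open>l / 2\<close>, and every further application of \<open>deficit_spreads\<close> lengthens that interval by \<open>l / 2\<close>.
  The margins \<open>l / 4\<close> ensure that, at each point of the new interval, the window \<open>[z - b, z - a]\<close> meets the
  old interval in length at least \<open>l / 4\<close>.
\<close>

lemma deficit_spreads_interval:
  fixes i :: nat and l :: real
  defines "l \<equiv> b - a"
  assumes V: "solution V" and x: "0 \<le> x"
    and M: "\<And>z. x - t \<le> z \<Longrightarrow> V z \<le> M"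
    and p: "x \<le> p" and m: "0 \<le> m"
    and mass: "m \<le> window_integral (\<lambda>y. M - V y) p (p + l / 2)"
    and z: "p + l / 2 + a + i * (a + l / 4) \<le> z" "z \<le> p + b + i * (b - l / 4)"
  shows "\<kappa> * m * (\<kappa> * l / 4) ^ i \<le> M - V z"
  using z
proof (induction i arbitrary: z)
  have [measurable]: "V \<in> borel_measurable borel" by (rule solution_measurable[OF V])
  have l: "0 < l" using a_less_b by (simp add: l_def)
  {
    case 0
    obtain K where K: "0 \<le> K" "\<And>y. y \<le> z \<Longrightarrow> \<bar>V y\<bar> \<le> K"
      using solution_locally_bounded[OF V, of z] by blast
    have z: "p + l / 2 \<le> z - a" "z - b \<le> p" "x \<le> z"
      using 0 p a_pos l by auto
    have "window_integral (\<lambda>y. M - V y) p (p + l / 2) \<le> window_integral (\<lambda>y. M - V y) (z - b) (z - a)"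
    proof (rule window_integral_subset[where K = "\<bar>M\<bar> + K"])
      fix y assume y: "z - b < y" "y \<le> z - a"
      have "x - t \<le> y" using y(1) z(1) p l b_le a_pos unfolding l_def by argo
      then show "0 \<le> M - V y \<and> M - V y \<le> \<bar>M\<bar> + K"
        using K(2)[of y] M[of y] y a_pos by auto
    qed (use z in auto)
    then have "\<kappa> * m \<le> \<kappa> * window_integral (\<lambda>y. M - V y) (z - b) (z - a)"
      using mass \<kappa>_pos by (intro mult_left_mono) auto
    also have "\<dots> \<le> M - V z"
      by (rule deficit_spreads[OF V x M z(3)])
    finally show ?case by simp
  next
    case (Suc i)
    obtain K where K: "0 \<le> K" "\<And>y. y \<le> z \<Longrightarrow> \<bar>V y\<bar> \<le> K"
      using solution_locally_bounded[OF V, of z] by blast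
    let ?c = "\<kappa> * m * (\<kappa> * l / 4) ^ i"
    let ?u = "p + l / 2 + a + i * (a + l / 4)" and ?v = "p + b + i * (b - l / 4)"
    define u where "u = max ?u (z - b)"
    define v where "v = min ?v (z - a)"
    have c0: "0 \<le> ?c" using \<kappa>_pos m l by auto
    have bl: "b = a + l" by (simp add: l_def)
    have il: "0 \<le> real i * l" using l by auto
    have z: "?u + a + l / 4 \<le> z" "z \<le> ?v + b - l / 4"
      using Suc.prems by (simp_all add: algebra_simps add_divide_distrib)
    have iA: "0 \<le> real i * a" using a_pos by auto
    have expand: "i * (a + l / 4) = i * a + i * l / 4" "i * (b - l / 4) = i * a + 3 * (i * l / 4)"
      unfolding bl by (simp_all add: algebra_simps)
    have "l / 4 \<le> ?v - ?u" "l / 4 \<le> ?v - (z - b)" "l / 4 \<le> z - a - ?u" "l / 4 \<le> z - a - (z - b)"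
      using z l il iA unfolding expand unfolding bl by linarith+
    then have uv: "l / 4 \<le> v - u" unfolding u_def v_def by linarith
    have "x \<le> ?u" using p a_pos l il iA unfolding expand by linarith
    then have xz: "x \<le> z" and ux: "x \<le> u"
      using z(1) a_pos l unfolding u_def by linarith+
    have "(l / 4) * ?c \<le> (v - u) * ?c" using uv c0 by (intro mult_right_mono)
    also have "\<dots> = window_integral (\<lambda>_. ?c) u v"
      using uv l by (intro window_integral_const[symmetric]) auto
    also have "\<dots> \<le> window_integral (\<lambda>y. M - V y) u v"
    proof (rule window_integral_mono[where K = "?c + \<bar>M\<bar> + K"])
      fix y assume y: "u < y" "y \<le> v"
      show "?c \<le> M - V y"
        using y by (intro Suc.IH) (auto simp: u_def v_def)
      have "\<bar>V y\<bar> \<le> K" using y a_pos by (intro K) (auto simp: v_def)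
      then show "\<bar>?c\<bar> \<le> ?c + \<bar>M\<bar> + K \<and> \<bar>M - V y\<bar> \<le> ?c + \<bar>M\<bar> + K"
        using c0 K(1) by linarith
    qed measurable
    also have "\<dots> \<le> window_integral (\<lambda>y. M - V y) (z - b) (z - a)"
    proof (rule window_integral_subset[where K = "\<bar>M\<bar> + K"])
      fix y assume y: "z - b < y" "y \<le> z - a"
      have "x - t \<le> y" using y xz b_le by auto
      then show "0 \<le> M - V y \<and> M - V y \<le> \<bar>M\<bar> + K"
        using K(2)[of y] M[of y] y a_pos by auto
    qed (auto simp: u_def v_def)
    finally have "\<kappa> * ((l / 4) * ?c) \<le> \<kappa> * window_integral (\<lambda>y. M - V y) (z - b) (z - a)"
      using \<kappa>_pos by (intro mult_left_mono) auto
    also have "\<dots> \<le> M - V z"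
      by (rule deficit_spreads[OF V x M xz])
    finally show ?case by (simp add: algebra_simps)
  }
qed

text \<open>
  The window of length \<open>t\<close> is covered by \<open>n\<close> pieces of length \<open>l / 2\<close>; one of them carries a fraction \<open>1 / n\<close>
  of the deficit.  After \<open>n\<close> spreading steps the deficit is bounded below on an interval longer than
  \<open>t\<close>, and the maximum principle preserves the improved bound.
\<close>

lemma deficit_contracts:
  fixes n :: nat and l :: real
  defines "l \<equiv> b - a"
  assumes V: "solution V" and x: "0 \<le> x"
    and M: "\<And>z. x - t \<le> z \<Longrightarrow> V z \<le> M"
    and n: "2 * t \<le> n * l"
    and z: "x + (n + 1) * (a + l) + t \<le> z"
  shows "(M * mean - flow V 0) * (\<kappa> / n * (\<kappa> * l / 4) ^ n) \<le> M - V z"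
proof -
  have [measurable]: "V \<in> borel_measurable borel" by (rule solution_measurable[OF V])
  have l: "0 < l" using a_less_b by (simp add: l_def)
  have bl: "b = a + l" by (simp add: l_def)
  have n0: "0 < n" using n t_pos l by (cases n) auto
  define m where "m = M * mean - flow V 0"
  have m0: "0 \<le> m" unfolding m_def
    by (rule deficit_mass(2)[OF V]) (use x t_pos in \<open>auto intro: M\<close>)
  obtain K where K: "0 \<le> K" "\<And>y. y \<le> x + n * (l / 2) \<Longrightarrow> \<bar>V y\<bar> \<le> K"
    using solution_locally_bounded[OF V, of "x + n * (l / 2)"] by blast
  have "m \<le> window_integral (\<lambda>y. M - V y) (x + t - t) (x + t)"
    unfolding m_def by (rule deficit_mass(1)[OF V]) (use x t_pos in \<open>auto intro: M\<close>)
  also have "\<dots> \<le> window_integral (\<lambda>y. M - V y) x (x + n * (l / 2))"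
  proof (rule window_integral_subset[where K = "\<bar>M\<bar> + K"])
    fix y assume y: "x < y" "y \<le> x + n * (l / 2)"
    show "0 \<le> M - V y \<and> M - V y \<le> \<bar>M\<bar> + K"
      using K(2)[of y] M[of y] y t_pos by auto
  qed (use n in auto)
  finally have mass: "m \<le> window_integral (\<lambda>y. M - V y) x (x + n * (l / 2))" .
  obtain j where j: "j < n"
      "m / n \<le> window_integral (\<lambda>y. M - V y) (x + j * (l / 2)) (x + j * (l / 2) + l / 2)"
  proof (rule window_pigeonhole[OF _ n0 _ _ mass])
    show "\<bar>M - V y\<bar> \<le> \<bar>M\<bar> + K" if "x < y" "y \<le> x + n * (l / 2)" for y
      using K(2)[of y] that by linarith
  qed (use l in auto)
  define p where "p = x + j * (l / 2)"
  define q where "q = p + l / 2 + a + n * (a + l / 4)"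
  have jl: "j * l \<le> n * l" "0 \<le> real j * l" using j l by (auto intro: mult_right_mono)
  have na: "0 \<le> real n * a" "0 \<le> real n * l" using a_pos l by auto
  have px: "x \<le> p" using jl by (simp add: p_def)
  have low: "\<kappa> * (m / n) * (\<kappa> * l / 4) ^ n \<le> M - V y" if y: "q \<le> y" "y < q + t" for y
  proof (rule deficit_spreads_interval[OF V x M px, folded l_def])
    show "0 \<le> m / n" using m0 by simp
    show "m / n \<le> window_integral (\<lambda>y. M - V y) p (p + l / 2)"
      using j(2) by (simp add: p_def)
    show "p + l / 2 + a + n * (a + l / 4) \<le> y" using y by (simp add: q_def)
    show "y \<le> p + b + n * (b - l / 4)"
      using y n l na unfolding q_def bl by (auto simp: algebra_simps)
  qed auto
  have "V z \<le> M - \<kappa> * (m / n) * (\<kappa> * l / 4) ^ n"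
  proof (rule maximum_principle[OF V])
    show "0 \<le> q + t" using px x l a_pos t_pos na by (simp add: q_def algebra_simps)
    show "V y \<le> M - \<kappa> * (m / n) * (\<kappa> * l / 4) ^ n" if "q + t - t \<le> y" "y < q + t" for y
      using low[of y] that by auto
    have "q \<le> x + (n + 1) * (a + l)"
      using jl na l unfolding q_def p_def
      by (simp only: distrib_left distrib_right of_nat_add of_nat_1)
    then show "q + t \<le> z" using z by simp
  qed
  then show ?thesis by (simp add: m_def algebra_simps)
qed

lemma mean_lower_bound: "(b - a) * (\<kappa> * a) \<le> mean"
proof -
  have "(b - a) * (\<kappa> * a) = (LINT y|lborel. indicator {a..b} y * (\<kappa> * a))"
    using a_less_b by simp
  also have "\<dots> \<le> mean"
    unfolding mean_def
  proof (rule integral_mono)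
    show "integrable lborel (\<lambda>y. indicator {a..b} y * (\<kappa> * a))"
      by (intro integrable_mult_left integrable_real_indicator) (use a_less_b in auto)
    show "integrable lborel (\<lambda>u. k u * u)"
      by (rule k_weighted_integrable[where K = t]) auto
    show "indicator {a..b} y * (\<kappa> * a) \<le> k y * y" for y
    proof (cases "y \<in> {0..t}")
      case True
      then show ?thesis
        using minorization[of y] k_nonneg[of y] a_pos \<kappa>_pos by (auto simp: indicator_def intro!: mult_mono)
    qed (use a_pos b_le in \<open>auto simp: k_supp indicator_def\<close>)
  qed
  finally show ?thesis .
qed

lemma mean_pos: "0 < mean"
proof -
  have "0 < (b - a) * (\<kappa> * a)" using a_less_b \<kappa>_pos a_pos by auto
  then show ?thesis using mean_lower_bound by linarith
qed

text \<open>
  The only constant whose flow is that of \<open>V\<close>.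
\<close>

definition limit :: "(real \<Rightarrow> real) \<Rightarrow> real" where
  "limit V = flow V 0 / mean"

lemma upper_convergence:
  fixes n i :: nat and l :: real
  defines "l \<equiv> b - a"
  assumes V: "solution V" and M: "\<And>z. V z \<le> M"
    and n: "2 * t \<le> n * l"
    and \<theta>: "\<theta> \<le> mean * (\<kappa> / n * (\<kappa> * l / 4) ^ n)" "\<theta> \<le> 1"
    and z: "i * ((n + 1) * (a + l) + 2 * t) \<le> z"
  shows "V z - limit V \<le> (1 - \<theta>) ^ i * (M - limit V)"
  using z
proof (induction i arbitrary: z)
  case 0
  then show ?case using M by simp
next
  case (Suc i)
  let ?L = "(n + 1) * (a + l) + 2 * t" and ?M = "limit V + (1 - \<theta>) ^ i * (M - limit V)"
  have lim: "(M' - limit V) * mean = M' * mean - flow V 0" for M'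
    using mean_pos by (simp add: limit_def field_simps)
  have V_le: "V y \<le> ?M" if "i * ?L + t - t \<le> y" for y
    using Suc.IH[of y] that by simp
  have L: "0 \<le> real i * ?L"
    using a_pos a_less_b t_pos by (intro mult_nonneg_nonneg add_nonneg_nonneg) (auto simp: l_def)
  define P where "P = (1 - \<theta>) ^ i * (M - limit V)"
  define c where "c = \<kappa> / n * (\<kappa> * l / 4) ^ n"
  have "(?M * mean - flow V 0) * c \<le> ?M - V z"
    unfolding l_def c_def
  proof (rule deficit_contracts[OF V _ V_le])
    show "0 \<le> i * ?L + t" using L t_pos by linarith
    show "i * ?L + t + (n + 1) * (a + (b - a)) + t \<le> z"
      using Suc.prems by (simp add: l_def algebra_simps)
  qed (use n in \<open>auto simp: l_def\<close>)
  moreover have "?M * mean - flow V 0 = P * mean"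
    unfolding lim[symmetric] by (simp add: P_def)
  ultimately have "P * mean * c \<le> limit V + P - V z" by (simp add: P_def)
  moreover have "\<theta> * P \<le> mean * c * P"
    unfolding P_def c_def
  proof (intro mult_right_mono \<theta> mult_nonneg_nonneg)
    have "0 \<le> M * mean - flow V 0"
      by (rule deficit_mass(2)[OF V, of 0]) (auto intro: M)
    then show "0 \<le> M - limit V" using mean_pos by (simp add: limit_def field_simps)
  qed (use \<theta> in auto)
  moreover have "mean * c * P = P * mean * c" by simp
  moreover have "(1 - \<theta>) ^ Suc i * (M - limit V) = P - \<theta> * P"
    by (simp add: P_def algebra_simps)
  ultimately show ?case by linarith
qed

lemma flow_uminus: "flow (\<lambda>z. - V z) x = - flow V x"
proof -
  have "window_integral (\<lambda>z. - V z) c d = - window_integral V c d" for c d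
    unfolding window_integral_def Bochner_Integration.integral_minus[symmetric]
    by (intro Bochner_Integration.integral_cong) auto
  then show ?thesis by (simp add: flow_def)
qed

text \<open>
  The lower estimate is the upper one for \<open>-V\<close>, started from the bound \<open>-V \<le> 0\<close>.  The limit lies in
  \<open>[0, 1]\<close>, so both initial gaps are at most \<open>1\<close>.
\<close>

lemma convergence:
  fixes n i :: nat and l :: real
  defines "l \<equiv> b - a"
  assumes V: "solution V" and M: "\<And>z. 0 \<le> V z" "\<And>z. V z \<le> 1"
    and n: "2 * t \<le> n * l"
    and \<theta>: "\<theta> \<le> mean * (\<kappa> / n * (\<kappa> * l / 4) ^ n)" "\<theta> \<le> 1"
    and z: "i * ((n + 1) * (a + l) + 2 * t) \<le> z"
  shows "\<bar>V z - limit V\<bar> \<le> (1 - \<theta>) ^ i"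
proof -
  have lim_neg: "limit (\<lambda>z. - V z) = - limit V"
    by (simp add: limit_def flow_uminus)
  have 1: "V z - limit V \<le> (1 - \<theta>) ^ i * (1 - limit V)"
    using upper_convergence[OF V M(2) n[unfolded l_def] \<theta>[unfolded l_def] z[unfolded l_def]] .
  have 2: "- V z - limit (\<lambda>z. - V z) \<le> (1 - \<theta>) ^ i * (0 - limit (\<lambda>z. - V z))"
    using upper_convergence[OF solution_uminus[OF V] _ n[unfolded l_def] \<theta>[unfolded l_def] z[unfolded l_def], of 0]
      M(1) by simp
  have "0 \<le> flow V 0"
    unfolding flow_def using k_nonneg M(1)
    by (intro Bochner_Integration.integral_nonneg mult_nonneg_nonneg window_integral_nonneg) auto
  then have lim0: "0 \<le> limit V" using mean_pos by (simp add: limit_def)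
  have "0 \<le> 1 * mean - flow V 0"
    by (rule deficit_mass(2)[OF V, of 0]) (auto intro: M)
  then have lim1: "limit V \<le> 1" using mean_pos by (simp add: limit_def field_simps)
  have p: "0 \<le> (1 - \<theta>) ^ i" using \<theta> by auto
  have "(1 - \<theta>) ^ i * (1 - limit V) \<le> (1 - \<theta>) ^ i" "(1 - \<theta>) ^ i * limit V \<le> (1 - \<theta>) ^ i"
    using lim0 lim1 p by (auto intro: mult_left_le)
  with 1 2 show ?thesis by (simp add: lim_neg)
qed

end

section \<open>The time lost to failures\<close>

text \<open>
  The lost time as a function of a fixed task time and of the sequence of failure times.  It has the
  value \<open>\<infinity>\<close> on sequences that never exceed \<open>t\<close> and are not summable, so that no case distinction on \<open>N\<close> is needed.
\<close>

definition lost_time :: "real \<Rightarrow> (nat \<Rightarrow> real) \<Rightarrow> ennreal" where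
  "lost_time t s = (\<Sum>i. if \<forall>j\<le>i. s j \<le> t then ennreal (s i) else 0)"

lemma restart_S_eq_lost_time: "restart_S T U \<omega> = lost_time (T \<omega>) (\<lambda>i. U (i + 1) \<omega>)"
proof -
  have "enat (i + 1) \<le> restart_N T U \<omega> \<longleftrightarrow> (\<forall>j\<le>i. U (j + 1) \<omega> \<le> T \<omega>)" for i
    unfolding restart_N_def le_INF_iff by (simp add: Suc_le_eq) (metis linorder_not_le)
  then show ?thesis
    unfolding restart_S_def lost_time_def by simp
qed

text \<open>
  The restart property: after a failure the remaining attempts see the shifted sequence.
\<close>

lemma lost_time_case_nat:
  "lost_time t (case_nat y s) = (if y \<le> t then ennreal y + lost_time t s else 0)"
proof -
  let ?f = "\<lambda>i. if \<forall>j\<le>i. case_nat y s j \<le> t then ennreal (case_nat y s i) else 0"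
  have head: "suminf h = (\<Sum>i. h (Suc i)) + h 0" for h :: "nat \<Rightarrow> ennreal"
    using suminf_offset[of h 1] by simp
  have all: "(\<forall>j\<le>Suc i. case_nat y s j \<le> t) \<longleftrightarrow> y \<le> t \<and> (\<forall>j\<le>i. s j \<le> t)" for i
    by (auto simp: less_Suc_eq_le split: nat.splits)
  have "lost_time t (case_nat y s) = (\<Sum>i. ?f (Suc i)) + ?f 0"
    unfolding lost_time_def by (rule head)
  also have "\<dots> = (\<Sum>i. if y \<le> t \<and> (\<forall>j\<le>i. s j \<le> t) then ennreal (s i) else 0) + (if y \<le> t then ennreal y else 0)"
    unfolding all nat.case by simp
  finally show ?thesis by (auto simp: lost_time_def add.commute)
qed

lemma measurable_lost_time [measurable]:
  "(\<lambda>(t, s). lost_time t s) \<in> borel_measurable (borel \<Otimes>\<^sub>M (\<Pi>\<^sub>M i\<in>(UNIV :: nat set). borel))"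
proof -
  have [measurable]: "(\<lambda>p. snd p i) \<in> borel_measurable ((borel :: real measure) \<Otimes>\<^sub>M (\<Pi>\<^sub>M i\<in>(UNIV :: nat set). (borel :: real measure)))"
    for i
    by (rule measurable_compose[OF measurable_snd measurable_component_singleton]) simp
  show ?thesis
    unfolding lost_time_def split_beta' by measurable
qed

lemma exceeds_add_ennreal:
  assumes "0 \<le> x" "0 \<le> y"
  shows "ennreal x < ennreal y + L \<longleftrightarrow> x - y < 0 \<or> ennreal (x - y) < L"
proof (cases "x < y")
  case True
  then have "ennreal x < ennreal y" using assms by (simp add: ennreal_lessI)
  then show ?thesis using True by (simp add: order_less_le_trans)
next
  case False
  then have x: "ennreal x = ennreal y + ennreal (x - y)"
    using assms by (subst ennreal_plus[symmetric]) auto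
  show ?thesis
    unfolding x ennreal_add_left_cancel_less using False by simp
qed

text \<open>
  The failure density in isolation, with task times as a parameter.
\<close>

locale failure_law =
  fixes g :: "real \<Rightarrow> real"
  assumes g_nonneg: "0 \<le> g y"
    and g_measurable [measurable]: "g \<in> borel_measurable borel"
    and g_total: "(\<integral>\<^sup>+y. ennreal (g y) \<partial>lborel) = 1"
    and g_neg: "AE y in lborel. y < 0 \<longrightarrow> g y = 0"
begin

definition law :: "real measure" where
  "law = density lborel (\<lambda>y. ennreal (g y))"

definition seq_law :: "(nat \<Rightarrow> real) measure" where
  "seq_law = (\<Pi>\<^sub>M i\<in>(UNIV :: nat set). law)"

lemma sets_law [measurable_cong]: "sets law = sets borel"
  by (simp add: law_def)

lemma space_law [simp]: "space law = UNIV"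
  by (simp add: law_def)

lemma sets_seq_law [measurable_cong]: "sets seq_law = sets (\<Pi>\<^sub>M i\<in>(UNIV :: nat set). borel)"
  unfolding seq_law_def by (intro sets_PiM_cong) (auto simp: sets_law)

lemma space_seq_law [simp]: "space seq_law = UNIV"
  by (simp add: seq_law_def space_PiM)

lemma prob_space_law: "prob_space law"
  by (rule prob_spaceI) (simp add: law_def emeasure_density g_total)

lemma prob_space_seq_law: "prob_space seq_law"
  unfolding seq_law_def by (intro prob_space_PiM prob_space_law)

text \<open>
  The disjunct \<open>u < 0\<close> is needed because \<open>ennreal\<close> sends negative reals to \<open>0\<close>: the tail at a negative
  argument has to be \<open>1\<close>.
\<close>

definition lost_tail :: "real \<Rightarrow> real \<Rightarrow> real" where
  "lost_tail t u = measure seq_law {s. u < 0 \<or> ennreal u < lost_time t s}"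

lemma lost_tail_nonneg: "0 \<le> lost_tail t u"
  by (simp add: lost_tail_def)

lemma lost_tail_le_1: "lost_tail t u \<le> 1"
  unfolding lost_tail_def by (rule prob_space.prob_le_1[OF prob_space_seq_law])

lemma lost_tail_neg: "u < 0 \<Longrightarrow> lost_tail t u = 1"
  unfolding lost_tail_def using prob_space.prob_space[OF prob_space_seq_law] by simp

lemma emeasure_lost_tail:
  "emeasure seq_law {s. u < 0 \<or> ennreal u < lost_time t s} = ennreal (lost_tail t u)"
  unfolding lost_tail_def
  by (rule finite_measure.emeasure_eq_measure[OF prob_space.finite_measure[OF prob_space_seq_law]])

lemma measurable_lost_tail [measurable]:
  "(\<lambda>(t, u). lost_tail t u) \<in> borel_measurable (borel \<Otimes>\<^sub>M borel)"
proof -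
  interpret S: prob_space seq_law by (rule prob_space_seq_law)
  let ?A = "{p \<in> space ((borel \<Otimes>\<^sub>M borel) \<Otimes>\<^sub>M seq_law).
    snd (fst p) < 0 \<or> ennreal (snd (fst p)) < lost_time (fst (fst p)) (snd p)}"
  have A: "?A \<in> sets ((borel \<Otimes>\<^sub>M borel) \<Otimes>\<^sub>M seq_law)"
    by measurable
  have eq: "Pair (t, u) -` ?A = {s. u < 0 \<or> ennreal u < lost_time t s}" for t u
    by (auto simp: space_pair_measure)
  have "(\<lambda>p. enn2real (emeasure seq_law (Pair p -` ?A))) \<in> borel_measurable (borel \<Otimes>\<^sub>M borel)"
    using S.measurable_emeasure_Pair[OF A] by measurable
  moreover have "(\<lambda>(t, u). lost_tail t u) = (\<lambda>p. enn2real (emeasure seq_law (Pair p -` ?A)))"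
    by (simp only: fun_eq_iff split_paired_All prod.case eq lost_tail_def measure_def simp_thms)
  ultimately show ?thesis by simp
qed

text \<open>
  A sequence of independent failure times has the same law as a single failure time put in front of
  an independent copy of the sequence; conditioning on the first entry gives the equation.
\<close>

lemma lost_tail_renewal:
  assumes u: "0 \<le> u"
  shows "lost_tail t u = (LINT y|lborel. (if 0 \<le> y \<and> y \<le> t then g y else 0) * lost_tail t (u - y))"
proof -
  interpret S: prob_space seq_law by (rule prob_space_seq_law)
  interpret Q: prob_space law by (rule prob_space_law)
  interpret sequence_space law ..
  let ?A = "{s. u < 0 \<or> ennreal u < lost_time t s}"
  let ?B = "(\<lambda>(y, s). case_nat y s) -` ?A \<inter> space (law \<Otimes>\<^sub>M seq_law)"
  have A: "?A \<in> sets seq_law"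
  proof -
    have "{s \<in> space seq_law. u < 0 \<or> ennreal u < lost_time t s} \<in> sets seq_law" by measurable
    then show ?thesis by simp
  qed
  have cn [measurable]: "(\<lambda>(y, s). case_nat y s) \<in> measurable (law \<Otimes>\<^sub>M seq_law) seq_law"
    unfolding seq_law_def split_beta' by (rule measurable_case_nat') auto
  have "ennreal (lost_tail t u) = emeasure (distr (law \<Otimes>\<^sub>M seq_law) seq_law (\<lambda>(y, s). case_nat y s)) ?A"
    using PiM_iter by (simp add: seq_law_def[symmetric] emeasure_lost_tail)
  also have "\<dots> = emeasure (law \<Otimes>\<^sub>M seq_law) ?B"
    by (rule emeasure_distr[OF cn A])
  also have "\<dots> = (\<integral>\<^sup>+y. emeasure seq_law (Pair y -` ?B) \<partial>law)"
    by (rule S.emeasure_pair_measure_alt) (rule measurable_sets[OF cn A])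
  also have "\<dots> = (\<integral>\<^sup>+y. ennreal (g y) * emeasure seq_law (Pair y -` ?B) \<partial>lborel)"
    unfolding law_def
    by (rule nn_integral_density)
      (use S.measurable_emeasure_Pair[OF measurable_sets[OF cn A]] in \<open>auto simp: law_def\<close>)
  also have "\<dots> = (\<integral>\<^sup>+y. ennreal ((if 0 \<le> y \<and> y \<le> t then g y else 0) * lost_tail t (u - y)) \<partial>lborel)"
  proof (rule nn_integral_cong_AE, use g_neg in eventually_elim)
    case (elim y)
    show ?case
    proof (cases "0 \<le> y")
      case True
      have "Pair y -` ?B = (if y \<le> t then {s. u - y < 0 \<or> ennreal (u - y) < lost_time t s} else {})"
        using u True by (auto simp: space_pair_measure lost_time_case_nat exceeds_add_ennreal)
      then show ?thesis
        using True g_nonneg[of y] emeasure_lost_tail[of "u - y" t]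
        by (simp add: ennreal_mult lost_tail_nonneg)
    qed (use elim in auto)
  qed
  finally have "ennreal (lost_tail t u) =
    (\<integral>\<^sup>+y. ennreal ((if 0 \<le> y \<and> y \<le> t then g y else 0) * lost_tail t (u - y)) \<partial>lborel)" .
  from arg_cong[OF this, of enn2real] show ?thesis
    by (subst integral_eq_nn_integral) (auto simp: g_nonneg lost_tail_nonneg)
qed

end

context restart_model
begin

lemma g_borel [measurable]: "g \<in> borel_measurable borel"
  using distributed_real_measurable[OF _ U_distributed[of 0]] g_nonneg by simp

lemma f_borel [measurable]: "f \<in> borel_measurable borel"
  using distributed_real_measurable[OF _ T_distributed] f_nonneg by simp

lemma nonneg_density:
  fixes X :: "'a \<Rightarrow> real"
  assumes X: "distributed M lborel X (\<lambda>y. ennreal (h y))" and "AE \<omega> in M. 0 \<le> X \<omega>"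
    and h: "\<And>y. 0 \<le> h y"
  shows "AE y in lborel. y < 0 \<longrightarrow> h y = (0::real)"
proof -
  have [measurable]: "h \<in> borel_measurable borel"
    using distributed_real_measurable[OF _ X] h by simp
  have "AE y in distr M lborel X. 0 \<le> y"
    using assms(2) distributed_measurable[OF X] by (subst AE_distr_iff) (auto simp flip: atLeast_def)
  then have "AE y in density lborel (\<lambda>y. ennreal (h y)). 0 \<le> y"
    by (simp only: distributed_distr_eq_density[OF X])
  then have "AE y in lborel. 0 < ennreal (h y) \<longrightarrow> 0 \<le> y"
    by (subst (asm) AE_density) auto
  then show ?thesis
    by eventually_elim (use h in \<open>auto simp: less_le\<close>)
qed

sublocale failure_law g
proof
  have "emeasure (distr M lborel (U 0)) UNIV = 1"
    using distributed_measurable[OF U_distributed[of 0]] emeasure_space_1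
    by (subst emeasure_distr) auto
  then show "(\<integral>\<^sup>+y. ennreal (g y) \<partial>lborel) = 1"
    by (simp add: distributed_distr_eq_density[OF U_distributed] emeasure_density)
  show "AE y in lborel. y < 0 \<longrightarrow> g y = 0"
    by (rule nonneg_density[OF U_distributed U_nonneg g_nonneg])
qed (use g_nonneg in auto)

lemma T_borel [measurable]: "T \<in> borel_measurable M"
  using distributed_measurable[OF T_distributed] by simp

lemma U_borel [measurable]: "U i \<in> borel_measurable M"
  using distributed_measurable[OF U_distributed] by simp

lemma distr_T: "distr M borel T = density lborel (\<lambda>t. ennreal (f t))"
  using distributed_distr_eq_density[OF T_distributed] by (simp cong: distr_cong)

lemma distr_U: "distr M borel (U i) = law"
  using distributed_distr_eq_density[OF U_distributed] by (simp add: law_def cong: distr_cong)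

text \<open>
  The family \<open>T, U 0, U 1, \<dots>\<close> is split into the blocks \<open>{0}\<close> and \<open>{2..}\<close>, which are independent.  Index \<open>i + 2\<close>
  of the family is the failure time \<open>U (i + 1)\<close> of attempt \<open>i\<close>, counted from \<open>0\<close>.
\<close>

lemma joint_law:
  "distr M (borel \<Otimes>\<^sub>M (\<Pi>\<^sub>M i\<in>(UNIV :: nat set). borel)) (\<lambda>\<omega>. (T \<omega>, \<lambda>i. U (i + 1) \<omega>))
     = density lborel (\<lambda>t. ennreal (f t)) \<Otimes>\<^sub>M seq_law"
proof -
  let ?P = "\<lambda>I. \<Pi>\<^sub>M i\<in>(I :: nat set). (borel :: real measure)"
  let ?Y = "case_nat T U"
  have Y: "random_variable borel (?Y i)" for i by (cases i) auto
  have shift: "(\<lambda>w. \<lambda>i. w (i + 2)) \<in> measurable (?P {2..}) (?P UNIV)"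
    by (rule measurable_PiM_single') (auto simp: space_PiM)
  have first: "(\<lambda>w. w 0) \<in> measurable (?P {0}) borel" by simp
  let ?R = "\<lambda>I \<omega>. restrict (\<lambda>i. ?Y i \<omega>) I"
  have R: "?R I \<in> measurable M (?P I)" for I
    by (intro measurable_restrict Y)
  have "indep_var (?P {0}) (?R {0}) (?P {2..}) (?R {2..})"
    by (rule indep_var_restrict[OF T_U_indep]) auto
  then have prod: "distr M (?P {0}) (?R {0}) \<Otimes>\<^sub>M distr M (?P {2..}) (?R {2..})
      = distr M (?P {0} \<Otimes>\<^sub>M ?P {2..}) (\<lambda>\<omega>. (?R {0} \<omega>, ?R {2..} \<omega>))"
    unfolding indep_var_distribution_eq by simp
  have T_eq: "distr (distr M (?P {0}) (?R {0})) borel (\<lambda>w. w 0) = distr M borel T"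
    by (subst distr_distr[OF first R]) (simp add: comp_def)
  have U_eq: "distr (distr M (?P {2..}) (?R {2..})) (?P UNIV) (\<lambda>w. \<lambda>i. w (i + 2))
      = distr M (?P UNIV) (\<lambda>\<omega> i. U (i + 1) \<omega>)"
    by (subst distr_distr[OF shift R]) (simp add: comp_def)
  have "distr M borel T \<Otimes>\<^sub>M distr M (?P UNIV) (\<lambda>\<omega> i. U (i + 1) \<omega>)
     = distr (distr M (?P {0}) (?R {0}) \<Otimes>\<^sub>M distr M (?P {2..}) (?R {2..})) (borel \<Otimes>\<^sub>M ?P UNIV)
         (\<lambda>(w, v). (w 0, \<lambda>i. v (i + 2)))"
    unfolding T_eq[symmetric] U_eq[symmetric]
  proof (rule pair_measure_distr)
    show "sigma_finite_measure (distr (distr M (?P {2..}) (?R {2..})) (?P UNIV) (\<lambda>w. \<lambda>i. w (i + 2)))"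
      using shift by (intro prob_space_imp_sigma_finite prob_space.prob_space_distr prob_space_distr R) auto
  qed (use first shift in auto)
  also have "\<dots> = distr M (borel \<Otimes>\<^sub>M ?P UNIV)
     ((\<lambda>(w, v). (w 0, \<lambda>i. v (i + 2))) \<circ> (\<lambda>\<omega>. (?R {0} \<omega>, ?R {2..} \<omega>)))"
    unfolding prod
  proof (rule distr_distr)
    show "(\<lambda>(w, v). (w 0, \<lambda>i. v (i + 2))) \<in> measurable (?P {0} \<Otimes>\<^sub>M ?P {2..}) (borel \<Otimes>\<^sub>M ?P UNIV)"
      unfolding split_beta'
      using measurable_compose[OF measurable_fst first] measurable_compose[OF measurable_snd shift]
      by (rule measurable_Pair)
    show "(\<lambda>\<omega>. (?R {0} \<omega>, ?R {2..} \<omega>)) \<in> measurable M (?P {0} \<Otimes>\<^sub>M ?P {2..})"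
      by (intro measurable_Pair R)
  qed
  also have "\<dots> = distr M (borel \<Otimes>\<^sub>M ?P UNIV) (\<lambda>\<omega>. (T \<omega>, \<lambda>i. U (i + 1) \<omega>))"
    by (simp add: comp_def)
  finally have "distr M (borel \<Otimes>\<^sub>M ?P UNIV) (\<lambda>\<omega>. (T \<omega>, \<lambda>i. U (i + 1) \<omega>))
      = distr M borel T \<Otimes>\<^sub>M distr M (?P UNIV) (\<lambda>\<omega> i. U (i + 1) \<omega>)" ..
  also have "distr M (?P UNIV) (\<lambda>\<omega> i. U (i + 1) \<omega>) = seq_law"
  proof -
    let ?D = "\<lambda>i. distr M borel (?Y i)"
    have "distr M (?P UNIV) (\<lambda>\<omega> i. ?Y i \<omega>) = Pi\<^sub>M UNIV ?D"
      using T_U_indep Y by (subst (asm) indep_vars_iff_distr_eq_PiM) (auto simp: restrict_UNIV)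
    moreover have "distr (Pi\<^sub>M UNIV ?D) (\<Pi>\<^sub>M i\<in>UNIV. ?D (i + 2)) (\<lambda>w. \<lambda>n\<in>UNIV. w (n + 2))
        = (\<Pi>\<^sub>M i\<in>UNIV. ?D (i + 2))"
      by (rule distr_PiM_reindex) (auto intro!: prob_space_distr Y injI)
    moreover have "(\<Pi>\<^sub>M i\<in>UNIV. ?D (i + 2)) = seq_law"
      by (simp add: distr_U seq_law_def)
    ultimately have "distr (distr M (?P UNIV) (\<lambda>\<omega> i. ?Y i \<omega>)) seq_law (\<lambda>w n. w (n + 2)) = seq_law"
      by (simp add: restrict_UNIV)
    moreover have "distr (distr M (?P UNIV) (\<lambda>\<omega> i. ?Y i \<omega>)) seq_law (\<lambda>w n. w (n + 2))
       = distr M seq_law ((\<lambda>w n. w (n + 2)) \<circ> (\<lambda>\<omega> i. ?Y i \<omega>))"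
    proof (rule distr_distr)
      show "(\<lambda>w n. w (n + 2)) \<in> measurable (?P UNIV) seq_law"
        unfolding measurable_cong_sets[OF refl sets_seq_law]
        by (rule measurable_PiM_single') (auto simp: space_PiM)
      show "(\<lambda>\<omega> i. ?Y i \<omega>) \<in> measurable M (?P UNIV)"
        by (rule measurable_PiM_single') (auto simp: space_PiM Y)
    qed
    ultimately show ?thesis
      by (simp add: comp_def sets_seq_law cong: distr_cong)
  qed
  finally show ?thesis by (simp add: distr_T)
qed

lemma total_time_tail:
  assumes x: "0 \<le> x"
  shows "tail_prob M (restart_X T U) (ennreal x) = (LINT t|lborel. f t * lost_tail t (x - t))"
proof -
  interpret S: prob_space seq_law by (rule prob_space_seq_law)
  let ?P = "\<Pi>\<^sub>M i\<in>(UNIV :: nat set). (borel :: real measure)"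
  let ?F = "density lborel (\<lambda>t. ennreal (f t))"
  let ?Y = "\<lambda>\<omega>. (T \<omega>, \<lambda>i. U (i + 1) \<omega>)"
  define A where "A = {p \<in> space (borel \<Otimes>\<^sub>M ?P). ennreal x < ennreal (fst p) + lost_time (fst p) (snd p)}"
  have A: "A \<in> sets (borel \<Otimes>\<^sub>M ?P)" unfolding A_def by measurable
  have A': "A \<in> sets (borel \<Otimes>\<^sub>M seq_law)"
  proof -
    have "sets ((borel :: real measure) \<Otimes>\<^sub>M seq_law) = sets (borel \<Otimes>\<^sub>M ?P)"
      by (intro sets_pair_measure_cong refl sets_seq_law)
    with A show ?thesis by (simp only:)
  qed
  have sets_eq: "sets (?F \<Otimes>\<^sub>M seq_law) = sets (borel \<Otimes>\<^sub>M ?P)"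
    by (intro sets_pair_measure_cong) (auto simp: sets_seq_law)
  have Y: "?Y \<in> measurable M (borel \<Otimes>\<^sub>M ?P)"
    by (intro measurable_Pair measurable_PiM_single') (auto simp: space_PiM)
  have "emeasure M {\<omega> \<in> space M. ennreal x < restart_X T U \<omega>} = emeasure M (?Y -` A \<inter> space M)"
    by (intro arg_cong2[where f = emeasure])
      (auto simp: A_def space_pair_measure space_PiM restart_X_def restart_S_eq_lost_time)
  also have "\<dots> = emeasure (?F \<Otimes>\<^sub>M seq_law) A"
    by (simp only: emeasure_distr[OF Y A, symmetric] joint_law)
  also have "\<dots> = (\<integral>\<^sup>+t. emeasure seq_law (Pair t -` A) \<partial>?F)"
    by (rule S.emeasure_pair_measure_alt) (simp only: sets_eq A)
  also have "\<dots> = (\<integral>\<^sup>+t. ennreal (f t) * emeasure seq_law (Pair t -` A) \<partial>lborel)"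
    by (rule nn_integral_density)
      (use S.measurable_emeasure_Pair[OF A'] in auto)
  also have "\<dots> = (\<integral>\<^sup>+t. ennreal (f t * lost_tail t (x - t)) \<partial>lborel)"
  proof (rule nn_integral_cong_AE, use nonneg_density[OF T_distributed T_nonneg f_nonneg] in eventually_elim)
    case (elim t)
    show ?case
    proof (cases "0 \<le> t")
      case True
      have "Pair t -` A = {s. x - t < 0 \<or> ennreal (x - t) < lost_time t s}"
        using x True by (auto simp: A_def space_pair_measure space_PiM exceeds_add_ennreal)
      then show ?thesis
        using f_nonneg[of t] emeasure_lost_tail[of "x - t" t]
        by (simp add: ennreal_mult lost_tail_nonneg)
    qed (use elim in auto)
  qed
  finally show ?thesis
    unfolding tail_prob_def measure_def
    by (subst integral_eq_nn_integral) (auto simp: f_nonneg lost_tail_nonneg)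
qed

lemma tail_prob_U:
  assumes "0 \<le> t"
  shows "tail_prob M (U i) t = 1 - (LINT y|lborel. (if 0 \<le> y \<and> y \<le> t then g y else 0))"
proof -
  have eq: "{\<omega> \<in> space M. t < U i \<omega>} = space M - (U i -` {..t} \<inter> space M)" by auto
  have "prob (U i -` {..t} \<inter> space M) = measure law {..t}"
    by (simp flip: distr_U[of i] add: measure_distr)
  also have "\<dots> = enn2real (\<integral>\<^sup>+y. ennreal (g y) * indicator {..t} y \<partial>lborel)"
    unfolding law_def measure_def by (subst emeasure_density) auto
  also have "(\<integral>\<^sup>+y. ennreal (g y) * indicator {..t} y \<partial>lborel)
    = (\<integral>\<^sup>+y. ennreal (if 0 \<le> y \<and> y \<le> t then g y else 0) \<partial>lborel)"
    by (rule nn_integral_cong_AE, use g_neg in eventually_elim) (auto simp: indicator_def)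
  also have "enn2real \<dots> = (LINT y|lborel. (if 0 \<le> y \<and> y \<le> t then g y else 0))"
    by (subst integral_eq_nn_integral) (auto simp: g_nonneg)
  finally show ?thesis
    unfolding tail_prob_def eq by (subst prob_compl) auto
qed

end

text \<open>
  Every point beyond the endpoint has a null neighbourhood, and by the Lindelof property countably
  many of them cover everything beyond the endpoint.
\<close>

lemma AE_le_upper_endpoint:
  fixes N :: "real measure"
  assumes N: "sets N = sets borel" and e: "upper_endpoint N = ereal t0"
  shows "AE t in N. t \<le> t0"
proof -
  have out: "\<exists>V. open V \<and> x \<in> V \<and> emeasure N V = 0" if "t0 < x" for x
  proof (rule ccontr)
    assume "\<not> ?thesis"
    then have "x \<in> measure_support N"
      by (auto simp: measure_support_def zero_less_iff_neq_zero)
    then have "ereal x \<le> upper_endpoint N"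
      unfolding upper_endpoint_def by (intro SUP_upper)
    with e that show False by simp
  qed
  define \<V> where "\<V> = {V. open V \<and> emeasure N V = 0}"
  obtain \<W> where \<W>: "\<W> \<subseteq> \<V>" "countable \<W>" "\<Union>\<W> = \<Union>\<V>"
    using Lindelof[of \<V>] by (auto simp: \<V>_def)
  have "(\<Union>W\<in>\<W>. W) \<in> null_sets N"
    by (rule null_sets_UN'[OF \<W>(2)]) (use \<W>(1) in \<open>auto simp: \<V>_def null_sets_def N\<close>)
  then have "AE t in N. t \<notin> \<Union>\<W>" by (auto dest: AE_not_in)
  then show ?thesis
  proof eventually_elim
    case (elim t)
    then have "t \<notin> \<Union>\<V>" using \<W>(3) by auto
    then show ?case using out[of t] by (force simp: \<V>_def)
  qed
qed

section \<open>Exponential tilting of the failure law\<close>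

context failure_law
begin

lemma g_integrable: "integrable lborel g"
  by (rule integrableI_nn_integral_finite[where x = 1]) (auto simp: g_nonneg g_total)

text \<open>
  With \<open>\<theta> = 0\<close> this is the failure density truncated at the task time.
\<close>

definition tilt :: "real \<Rightarrow> real \<Rightarrow> real \<Rightarrow> real" where
  "tilt \<theta> t y = (if 0 \<le> y \<and> y \<le> t then exp (\<theta> * y) * g y else 0)"

definition tilt_mass :: "real \<Rightarrow> real \<Rightarrow> real" where
  "tilt_mass \<theta> t = (LINT y|lborel. tilt \<theta> t y)"

definition tilt_mean :: "real \<Rightarrow> real \<Rightarrow> real" where
  "tilt_mean \<theta> t = (LINT y|lborel. tilt \<theta> t y * y)"

lemma measurable_tilt [measurable]: "tilt \<theta> t \<in> borel_measurable borel"
  unfolding tilt_def by measurable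

lemma tilt_nonneg: "0 \<le> tilt \<theta> t y"
  by (simp add: tilt_def g_nonneg)

lemma tilt_integrable: "integrable lborel (tilt \<theta> t)"
proof (rule Bochner_Integration.integrable_bound)
  show "integrable lborel (\<lambda>y. exp (\<bar>\<theta>\<bar> * \<bar>t\<bar>) * g y)"
    by (intro integrable_mult_right g_integrable)
  show "AE y in lborel. norm (tilt \<theta> t y) \<le> norm (exp (\<bar>\<theta>\<bar> * \<bar>t\<bar>) * g y)"
  proof (rule AE_I2)
    fix y
    show "norm (tilt \<theta> t y) \<le> norm (exp (\<bar>\<theta>\<bar> * \<bar>t\<bar>) * g y)"
    proof (cases "0 \<le> y \<and> y \<le> t")
      case True
      have "\<theta> * y \<le> \<bar>\<theta>\<bar> * y" using True by (intro mult_right_mono) auto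
      also have "\<dots> \<le> \<bar>\<theta>\<bar> * \<bar>t\<bar>" using True by (intro mult_left_mono) auto
      finally have "exp (\<theta> * y) * g y \<le> exp (\<bar>\<theta>\<bar> * \<bar>t\<bar>) * g y"
        by (intro mult_right_mono g_nonneg) simp
      then show ?thesis using True g_nonneg[of y] by (simp add: tilt_def)
    qed (auto simp: tilt_def)
  qed
qed measurable

lemma tilt_mean_integrable: "integrable lborel (\<lambda>y. tilt \<theta> t y * y)"
proof (rule Bochner_Integration.integrable_bound)
  show "integrable lborel (\<lambda>y. tilt \<theta> t y * t)"
    by (intro integrable_mult_left tilt_integrable)
  show "AE y in lborel. norm (tilt \<theta> t y * y) \<le> norm (tilt \<theta> t y * t)"
  proof (rule AE_I2)
    fix y
    show "norm (tilt \<theta> t y * y) \<le> norm (tilt \<theta> t y * t)"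
    proof (cases "0 \<le> y \<and> y \<le> t")
      case True
      then have "tilt \<theta> t y * y \<le> tilt \<theta> t y * t" "0 \<le> tilt \<theta> t y * y" "0 \<le> tilt \<theta> t y * t"
        using tilt_nonneg[of \<theta> t y] by (auto intro: mult_left_mono)
      then show ?thesis by simp
    next
      case False
      then have "tilt \<theta> t y = 0" by (auto simp: tilt_def)
      then show ?thesis by simp
    qed
  qed
qed measurable

lemma tilt_kernel:
  assumes "0 < \<theta>" "0 < t" "tilt_mass \<theta> t = 1" "tilt_mass 0 t < 1"
  shows "renewal_kernel (tilt \<theta> t) t \<theta>"
proof
  have "(LINT y|lborel. tilt \<theta> t y * exp (- \<theta> * y)) = tilt_mass 0 t"
    unfolding tilt_mass_def
    by (intro Bochner_Integration.integral_cong) (auto simp: tilt_def exp_minus)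
  then show "(LINT y|lborel. tilt \<theta> t y * exp (- \<theta> * y)) < 1" using assms by simp
  show "(LINT y|lborel. tilt \<theta> t y) = 1" using assms(3) by (simp add: tilt_mass_def)
  show "tilt \<theta> t y = 0" if "y \<notin> {0..t}" for y using that by (auto simp: tilt_def)
qed (rule assms tilt_nonneg tilt_integrable)+

definition tilted_tail :: "real \<Rightarrow> real \<Rightarrow> real \<Rightarrow> real" where
  "tilted_tail \<theta> t z = exp (\<theta> * z) * lost_tail t z"

lemma tilted_tail_nonneg: "0 \<le> tilted_tail \<theta> t z"
  by (simp add: tilted_tail_def lost_tail_nonneg)

lemma tilted_tail_measurable: "tilted_tail \<theta> t \<in> borel_measurable borel"
proof -
  have "lost_tail t \<in> borel_measurable borel"
    using measurable_compose[OF measurable_Pair1' measurable_lost_tail, of t] by simp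
  then show ?thesis unfolding tilted_tail_def[abs_def] by measurable
qed

lemma tilted_tail_solution:
  assumes "0 < \<theta>" "0 < t" "tilt_mass \<theta> t = 1" "tilt_mass 0 t < 1"
  shows "renewal_kernel.solution (tilt \<theta> t) \<theta> (tilted_tail \<theta> t)"
proof -
  interpret renewal_kernel "tilt \<theta> t" t \<theta> by (rule tilt_kernel[OF assms])
  have "\<bar>tilted_tail \<theta> t z\<bar> \<le> 1 * exp (\<theta> * z)" for z
    using lost_tail_nonneg[of t z] lost_tail_le_1[of t z] by (simp add: tilted_tail_def abs_mult)
  then have "\<exists>s\<ge>0. \<forall>z. \<bar>tilted_tail \<theta> t z\<bar> \<le> s * exp (\<theta> * z)"
    by (intro exI[of _ 1]) auto
  moreover have "tilted_tail \<theta> t z = (LINT y|lborel. tilt \<theta> t y * tilted_tail \<theta> t (z - y))"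
    if "0 \<le> z" for z
  proof -
    have "tilted_tail \<theta> t z
      = (LINT y|lborel. exp (\<theta> * z) * ((if 0 \<le> y \<and> y \<le> t then g y else 0) * lost_tail t (z - y)))"
      unfolding tilted_tail_def lost_tail_renewal[OF that, of t] by simp
    also have "\<dots> = (LINT y|lborel. tilt \<theta> t y * tilted_tail \<theta> t (z - y))"
    proof (intro Bochner_Integration.integral_cong refl)
      fix y
      have "exp (\<theta> * z) = exp (\<theta> * y) * exp (\<theta> * (z - y))"
        by (simp add: exp_add[symmetric] algebra_simps)
      then show "exp (\<theta> * z) * ((if 0 \<le> y \<and> y \<le> t then g y else 0) * lost_tail t (z - y))
          = tilt \<theta> t y * tilted_tail \<theta> t (z - y)"
        by (simp add: tilt_def tilted_tail_def)
    qed
    finally show ?thesis .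
  qed
  ultimately show ?thesis by (simp add: solution_def tilted_tail_measurable)
qed

text \<open>
  The bound holds on the negative half-line, where the untilted tail is \<open>1\<close>, and the maximum principle
  carries it over.
\<close>

lemma lundberg_bound:
  assumes "0 < \<theta>" "0 < t" "tilt_mass \<theta> t = 1" "tilt_mass 0 t < 1"
  shows "tilted_tail \<theta> t z \<le> 1"
proof -
  interpret renewal_kernel "tilt \<theta> t" t \<theta> by (rule tilt_kernel[OF assms])
  have neg: "tilted_tail \<theta> t z \<le> 1" if "z < 0" for z
    using that assms(1) by (simp add: tilted_tail_def lost_tail_neg mult_le_0_iff)
  show ?thesis
  proof (cases "z < 0")
    case False
    show ?thesis
      by (rule maximum_principle[OF tilted_tail_solution[OF assms], where x = 0]) (use False in \<open>auto intro: neg\<close>)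
  qed (rule neg)
qed

lemma lost_tail_le_exp:
  assumes "0 < \<theta>" "0 < t" "tilt_mass \<theta> t = 1" "tilt_mass 0 t < 1"
  shows "lost_tail t u \<le> exp (- \<theta> * u)"
proof -
  have "exp (- \<theta> * u) * (exp (\<theta> * u) * lost_tail t u) \<le> exp (- \<theta> * u) * 1"
    using lundberg_bound[OF assms, of u] by (intro mult_left_mono) (auto simp: tilted_tail_def)
  then show ?thesis by (simp add: mult.assoc[symmetric] exp_add[symmetric])
qed

lemma lost_tail_mono:
  assumes "t' \<le> t"
  shows "lost_tail t' u \<le> lost_tail t u"
proof -
  interpret S: prob_space seq_law by (rule prob_space_seq_law)
  have le: "lost_time t' s \<le> lost_time t s" for s
    unfolding lost_time_def
  proof (rule suminf_le)
    fix i
    have "(\<forall>j\<le>i. s j \<le> t') \<longrightarrow> (\<forall>j\<le>i. s j \<le> t)" using assms by (meson order_trans)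
    then show "(if \<forall>j\<le>i. s j \<le> t' then ennreal (s i) else 0) \<le> (if \<forall>j\<le>i. s j \<le> t then ennreal (s i) else 0)"
      by auto
  qed auto
  have [measurable]: "lost_time t \<in> borel_measurable seq_law"
    using measurable_compose[OF measurable_Pair1' measurable_lost_time, of t]
    unfolding measurable_cong_sets[OF sets_seq_law refl] by simp
  have "{s \<in> space seq_law. u < 0 \<or> ennreal u < lost_time t s} \<in> sets seq_law" by measurable
  then show ?thesis
    unfolding lost_tail_def by (intro S.finite_measure_mono) (auto dest: order_less_le_trans[OF _ le])
qed

text \<open>
  At time \<open>0\<close> the flow only sees negative arguments, where the tilted tail is \<open>e\<^bsup>\<theta> y\<^esup>\<close>.
\<close>

lemma initial_flow:
  assumes "0 < \<theta>" "0 < t" "tilt_mass \<theta> t = 1" "tilt_mass 0 t < 1"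
  shows "renewal_kernel.flow (tilt \<theta> t) (tilted_tail \<theta> t) 0 = (1 - tilt_mass 0 t) / \<theta>"
proof -
  interpret renewal_kernel "tilt \<theta> t" t \<theta> by (rule tilt_kernel[OF assms])
  have m [measurable]: "tilted_tail \<theta> t \<in> borel_measurable borel" by (rule tilted_tail_measurable)
  have win: "window_integral (tilted_tail \<theta> t) (0 - u) 0 = (1 - exp (- \<theta> * u)) / \<theta>" if "0 \<le> u" for u
  proof -
    have "window_integral (tilted_tail \<theta> t) (0 - u) 0
      = (LINT y|lborel. exp (\<theta> * y) * indicator {-u..0} y)"
      unfolding window_integral_def
    proof (rule integral_cong_AE)
      have "AE y in lborel. y \<noteq> 0" "AE y in lborel. y \<noteq> - u"
        by (rule AE_lborel_singleton)+
      then show "AE y in lborel. (if 0 - u < y \<and> y \<le> 0 then tilted_tail \<theta> t y else 0)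
          = exp (\<theta> * y) * indicator {-u..0} y"
        by eventually_elim (auto simp: indicator_def tilted_tail_def lost_tail_neg)
    qed (use m in measurable)
    also have "\<dots> = exp (\<theta> * 0) / \<theta> - exp (\<theta> * (- u)) / \<theta>"
      using that assms(1)
      by (intro integral_FTC_Icc_real[of "-u" 0 "\<lambda>y. exp (\<theta> * y) / \<theta>"])
        (auto intro!: derivative_eq_intros continuous_intros)
    finally show ?thesis using assms(1) by (simp add: diff_divide_distrib)
  qed
  have "flow (tilted_tail \<theta> t) 0 = (LINT u|lborel. (tilt \<theta> t u - tilt 0 t u) / \<theta>)"
    unfolding flow_def
  proof (intro Bochner_Integration.integral_cong refl)
    fix u
    show "tilt \<theta> t u * window_integral (tilted_tail \<theta> t) (0 - u) 0 = (tilt \<theta> t u - tilt 0 t u) / \<theta>"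
    proof (cases "0 \<le> u \<and> u \<le> t")
      case True
      have "tilt 0 t u = exp (- \<theta> * u) * tilt \<theta> t u"
        by (simp add: tilt_def exp_minus)
      then show ?thesis
        using win[of u] True by (simp add: right_diff_distrib mult.commute)
    next
      case False
      then have "tilt \<theta> t u = 0" "tilt 0 t u = 0" by (auto simp: tilt_def)
      then show ?thesis by simp
    qed
  qed
  also have "\<dots> = (tilt_mass \<theta> t - tilt_mass 0 t) / \<theta>"
    using tilt_integrable[of \<theta> t] tilt_integrable[of 0 t] by (simp add: tilt_mass_def)
  finally show ?thesis using assms(3) by simp
qed

lemma tilt_mass_continuous: "continuous_on {c..d} (\<lambda>\<theta>. tilt_mass \<theta> t)"
proof (rule continuous_on_sequentiallyI)
  fix \<theta> :: "nat \<Rightarrow> real" and \<theta>' assume \<theta>: "\<forall>n. \<theta> n \<in> {c..d}" "\<theta> \<longlonglongrightarrow> \<theta>'"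
  show "(\<lambda>n. tilt_mass (\<theta> n) t) \<longlonglongrightarrow> tilt_mass \<theta>' t"
    unfolding tilt_mass_def
  proof (rule integral_dominated_convergence)
    show "integrable lborel (tilt d t)" by (rule tilt_integrable)
    show "AE y in lborel. (\<lambda>n. tilt (\<theta> n) t y) \<longlonglongrightarrow> tilt \<theta>' t y"
      by (rule AE_I2) (auto simp: tilt_def intro!: tendsto_intros \<theta>(2))
    show "AE y in lborel. norm (tilt (\<theta> n) t y) \<le> tilt d t y" for n
      using \<theta>(1) by (intro AE_I2) (auto simp: tilt_def abs_mult g_nonneg intro!: mult_right_mono)
  qed measurable
qed

end

text \<open>
  Here \<open>\<gamma>\<close> is the exponent of the longest possible task.  Left continuity of \<open>g\<close> at \<open>t0\<close> controls the
  mass that is lost when the task becomes slightly shorter.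
\<close>

locale tilted_failure_law = failure_law +
  fixes t0 \<gamma> :: real
  assumes t0_pos: "0 < t0" and \<gamma>_pos: "0 < \<gamma>"
    and tilt_mass_\<gamma>: "tilt_mass \<gamma> t0 = 1"
    and tilt_mass_0: "tilt_mass 0 t0 < 1"
    and g_left: "(g \<longlongrightarrow> g t0) (at_left t0)"
    and g_pos: "0 < g t0"
begin

text \<open>
  The tilted mass that truncation at \<open>t\<close> instead of \<open>t0\<close> removes; all comparisons between \<open>t\<close> and \<open>t0\<close>
  are expressed through it.
\<close>

definition lost_mass :: "real \<Rightarrow> real" where
  "lost_mass t = (LINT y|lborel. (if t < y then tilt \<gamma> t0 y else 0))"

abbreviation "edge \<equiv> exp (\<gamma> * t0) * g t0"

abbreviation "B \<equiv> tilt_mean \<gamma> t0"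

lemma lost_mass_integrable: "integrable lborel (\<lambda>y. if t < y then tilt \<gamma> t0 y else 0)"
proof (rule Bochner_Integration.integrable_bound[OF tilt_integrable[of \<gamma> t0]])
  show "AE y in lborel. norm (if t < y then tilt \<gamma> t0 y else 0) \<le> norm (tilt \<gamma> t0 y)"
    by (rule AE_I2) auto
qed measurable

lemma lost_mass_nonneg: "0 \<le> lost_mass t"
  unfolding lost_mass_def by (intro Bochner_Integration.integral_nonneg) (auto simp: tilt_nonneg)

lemma tilt_mass_split:
  assumes "t \<le> t0"
  shows "tilt_mass \<gamma> t = 1 - lost_mass t"
proof -
  have "tilt_mass \<gamma> t = (LINT y|lborel. tilt \<gamma> t0 y - (if t < y then tilt \<gamma> t0 y else 0))"
    unfolding tilt_mass_def using assms
    by (intro Bochner_Integration.integral_cong) (auto simp: tilt_def)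
  also have "\<dots> = 1 - lost_mass t"
    unfolding lost_mass_def using tilt_mass_\<gamma> tilt_integrable lost_mass_integrable
    by (simp add: tilt_mass_def)
  finally show ?thesis .
qed

lemma tilt_mean_bounds:
  assumes "t \<le> t0"
  shows "B - t0 * lost_mass t \<le> tilt_mean \<gamma> t" "tilt_mean \<gamma> t \<le> B"
proof -
  have "B - t0 * lost_mass t
      = (LINT y|lborel. tilt \<gamma> t0 y * y - t0 * (if t < y then tilt \<gamma> t0 y else 0))"
    unfolding lost_mass_def tilt_mean_def using tilt_mean_integrable lost_mass_integrable by simp
  also have "\<dots> \<le> tilt_mean \<gamma> t"
    unfolding tilt_mean_def
  proof (intro integral_mono Bochner_Integration.integrable_diff integrable_mult_right
      tilt_mean_integrable lost_mass_integrable)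
    fix y
    have "tilt \<gamma> t0 y * y \<le> t0 * tilt \<gamma> t0 y"
      by (cases "0 \<le> y \<and> y \<le> t0")
        (use tilt_nonneg[of \<gamma> t0 y] in \<open>auto simp: tilt_def mult.commute intro!: mult_right_mono\<close>)
    then show "tilt \<gamma> t0 y * y - t0 * (if t < y then tilt \<gamma> t0 y else 0) \<le> tilt \<gamma> t y * y"
      using assms by (auto simp: tilt_def)
  qed
  finally show "B - t0 * lost_mass t \<le> tilt_mean \<gamma> t" .
  show "tilt_mean \<gamma> t \<le> B"
    unfolding tilt_mean_def
    by (intro integral_mono tilt_mean_integrable) (use assms in \<open>auto simp: tilt_def g_nonneg\<close>)
qed

lemma tilt_mass_0_bounds:
  assumes "t \<le> t0"
  shows "tilt_mass 0 t0 - lost_mass t \<le> tilt_mass 0 t" "tilt_mass 0 t \<le> tilt_mass 0 t0"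
proof -
  have "tilt_mass 0 t0 - lost_mass t
      = (LINT y|lborel. tilt 0 t0 y - (if t < y then tilt \<gamma> t0 y else 0))"
    unfolding lost_mass_def tilt_mass_def using tilt_integrable lost_mass_integrable by simp
  also have "\<dots> \<le> tilt_mass 0 t"
    unfolding tilt_mass_def
  proof (intro integral_mono Bochner_Integration.integrable_diff tilt_integrable lost_mass_integrable)
    fix y
    have "0 \<le> y \<Longrightarrow> 1 * g y \<le> exp (\<gamma> * y) * g y"
      using \<gamma>_pos by (intro mult_right_mono g_nonneg) auto
    then show "tilt 0 t0 y - (if t < y then tilt \<gamma> t0 y else 0) \<le> tilt 0 t y"
      by (auto simp: tilt_def g_nonneg)
  qed
  finally show "tilt_mass 0 t0 - lost_mass t \<le> tilt_mass 0 t" .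
  show "tilt_mass 0 t \<le> tilt_mass 0 t0"
    unfolding tilt_mass_def
    by (intro integral_mono tilt_integrable) (use assms in \<open>auto simp: tilt_def g_nonneg\<close>)
qed

lemma tilt_exp_split: "tilt \<theta> t y = exp ((\<theta> - \<gamma>) * y) * tilt \<gamma> t y"
  by (simp add: tilt_def exp_add[symmetric] algebra_simps)

text \<open>
  Since \<open>e\<^bsup>\<eta> y\<^esup> \<ge> 1 + \<eta> y\<close>, raising the exponent by \<open>\<eta> = lost_mass t / tilt_mean \<gamma> t\<close> restores at least the
  lost mass; the intermediate value theorem provides the exponent in between.
\<close>

lemma exponent_exists:
  assumes t: "t \<le> t0" and b: "0 < tilt_mean \<gamma> t"
  obtains \<theta> where "\<gamma> \<le> \<theta>" "\<theta> \<le> \<gamma> + lost_mass t / tilt_mean \<gamma> t" "tilt_mass \<theta> t = 1"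
proof -
  define \<eta> where "\<eta> = lost_mass t / tilt_mean \<gamma> t"
  have \<eta>: "0 \<le> \<eta>" using b lost_mass_nonneg by (simp add: \<eta>_def)
  have "1 = tilt_mass \<gamma> t + \<eta> * tilt_mean \<gamma> t"
    using b by (simp add: tilt_mass_split[OF t] \<eta>_def)
  also have "\<dots> = (LINT y|lborel. tilt \<gamma> t y + \<eta> * (tilt \<gamma> t y * y))"
    unfolding tilt_mass_def tilt_mean_def using tilt_integrable tilt_mean_integrable by simp
  also have "\<dots> \<le> tilt_mass (\<gamma> + \<eta>) t"
    unfolding tilt_mass_def
  proof (intro integral_mono Bochner_Integration.integrable_add integrable_mult_right
      tilt_integrable tilt_mean_integrable)
    fix y
    have "(1 + \<eta> * y) * tilt \<gamma> t y \<le> exp (\<eta> * y) * tilt \<gamma> t y"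
      by (intro mult_right_mono tilt_nonneg exp_ge_add_one_self)
    then show "tilt \<gamma> t y + \<eta> * (tilt \<gamma> t y * y) \<le> tilt (\<gamma> + \<eta>) t y"
      by (subst tilt_exp_split[of "\<gamma> + \<eta>"]) (simp add: algebra_simps)
  qed
  finally have "1 \<le> tilt_mass (\<gamma> + \<eta>) t" .
  moreover have "tilt_mass \<gamma> t \<le> 1" using lost_mass_nonneg by (simp add: tilt_mass_split[OF t])
  ultimately obtain \<theta> where "\<gamma> \<le> \<theta>" "\<theta> \<le> \<gamma> + \<eta>" "tilt_mass \<theta> t = 1"
    using IVT'[of "\<lambda>\<theta>. tilt_mass \<theta> t" \<gamma> 1 "\<gamma> + \<eta>"] \<eta> tilt_mass_continuous by auto
  then show ?thesis using that by (simp add: \<eta>_def)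
qed

text \<open>
  By \<open>e\<^sup>v \<le> 1 + v e\<^sup>v\<close>, raising the exponent by \<open>\<eta>\<close> restores at most \<open>\<eta> e\<^bsup>\<eta> t0\<^esup>\<close> times the mean, so the lost mass also
  bounds the necessary increase from below.
\<close>

lemma exponent_lower_bound:
  assumes t: "t \<le> t0" and \<theta>: "\<gamma> \<le> \<theta>" "tilt_mass \<theta> t = 1"
  shows "lost_mass t \<le> (\<theta> - \<gamma>) * exp ((\<theta> - \<gamma>) * t0) * tilt_mean \<gamma> t"
proof -
  let ?c = "(\<theta> - \<gamma>) * exp ((\<theta> - \<gamma>) * t0)"
  have "1 = tilt_mass \<theta> t" using \<theta> by simp
  also have "\<dots> \<le> (LINT y|lborel. tilt \<gamma> t y + ?c * (tilt \<gamma> t y * y))"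
    unfolding tilt_mass_def
  proof (intro integral_mono Bochner_Integration.integrable_add integrable_mult_right
      tilt_integrable tilt_mean_integrable)
    fix y
    show "tilt \<theta> t y \<le> tilt \<gamma> t y + ?c * (tilt \<gamma> t y * y)"
    proof (cases "0 \<le> y \<and> y \<le> t")
      case True
      define v where "v = (\<theta> - \<gamma>) * y"
      have v: "0 \<le> v" using True \<theta> by (simp add: v_def)
      have "(1 - v) * exp v \<le> exp (- v) * exp v"
        using exp_ge_add_one_self[of "-v"] by (intro mult_right_mono) auto
      then have "exp v \<le> 1 + v * exp v" by (simp add: exp_minus algebra_simps)
      also have "v * exp v \<le> v * exp ((\<theta> - \<gamma>) * t0)"
        using True t \<theta> v by (intro mult_left_mono) (auto simp: v_def intro!: mult_left_mono)
      finally have "exp v * tilt \<gamma> t y \<le> (1 + v * exp ((\<theta> - \<gamma>) * t0)) * tilt \<gamma> t y"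
        by (intro mult_right_mono tilt_nonneg) auto
      then show ?thesis
        by (subst tilt_exp_split) (simp add: v_def algebra_simps)
    qed (auto simp: tilt_def)
  qed
  also have "\<dots> = tilt_mass \<gamma> t + ?c * tilt_mean \<gamma> t"
    unfolding tilt_mass_def tilt_mean_def using tilt_integrable tilt_mean_integrable by simp
  finally show ?thesis by (simp add: tilt_mass_split[OF t])
qed

lemma tilt_mean_exponent_bounds:
  assumes t: "t \<le> t0" and \<theta>: "\<gamma> \<le> \<theta>"
  shows "tilt_mean \<gamma> t \<le> tilt_mean \<theta> t" "tilt_mean \<theta> t \<le> exp ((\<theta> - \<gamma>) * t0) * tilt_mean \<gamma> t"
proof -
  show "tilt_mean \<gamma> t \<le> tilt_mean \<theta> t"
    unfolding tilt_mean_def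
    by (intro integral_mono tilt_mean_integrable)
      (use \<theta> in \<open>auto simp: tilt_def g_nonneg intro!: mult_right_mono\<close>)
  have "tilt_mean \<theta> t \<le> (LINT y|lborel. exp ((\<theta> - \<gamma>) * t0) * (tilt \<gamma> t y * y))"
    unfolding tilt_mean_def
  proof (intro integral_mono tilt_mean_integrable integrable_mult_right)
    fix y
    show "tilt \<theta> t y * y \<le> exp ((\<theta> - \<gamma>) * t0) * (tilt \<gamma> t y * y)"
    proof (cases "0 \<le> y \<and> y \<le> t")
      case True
      then have "exp ((\<theta> - \<gamma>) * y) * (tilt \<gamma> t y * y) \<le> exp ((\<theta> - \<gamma>) * t0) * (tilt \<gamma> t y * y)"
        using t \<theta> tilt_nonneg[of \<gamma> t y] by (intro mult_right_mono) (auto intro!: mult_left_mono)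
      then show ?thesis by (subst tilt_exp_split) simp
    qed (auto simp: tilt_def)
  qed
  then show "tilt_mean \<theta> t \<le> exp ((\<theta> - \<gamma>) * t0) * tilt_mean \<gamma> t"
    by (simp add: tilt_mean_def)
qed

end

section \<open>Tilting parameters of short tasks near the endpoint\<close>

context tilted_failure_law
begin

lemma lost_mass_window:
  assumes "0 \<le> t"
  shows "lost_mass t = window_integral (\<lambda>y. exp (\<gamma> * y) * g y) t t0"
  unfolding lost_mass_def window_integral_def
  by (intro Bochner_Integration.integral_cong) (use assms in \<open>auto simp: tilt_def\<close>)

lemma lost_mass_rate: "((\<lambda>t. lost_mass t / (t0 - t)) \<longlongrightarrow> edge) (at_left t0)"
proof (rule tendstoI)
  fix \<epsilon> :: real assume \<epsilon>: "0 < \<epsilon>"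
  let ?w = "\<lambda>y. exp (\<gamma> * y) * g y"
  have "(?w \<longlongrightarrow> edge) (at_left t0)"
    by (intro tendsto_intros g_left)
  then have "eventually (\<lambda>y. dist (?w y) edge < \<epsilon> / 2) (at_left t0)"
    using \<epsilon> by (intro tendstoD) auto
  then obtain b where b: "b < t0" "\<And>y. b < y \<Longrightarrow> y < t0 \<Longrightarrow> dist (?w y) edge < \<epsilon> / 2"
    by (auto simp: eventually_at_left_field)
  have "eventually (\<lambda>t. max 0 b < t \<and> t < t0) (at_left t0)"
    using b(1) t0_pos by (auto simp: eventually_at_left_field intro: exI[of _ "max 0 b"])
  then show "eventually (\<lambda>t. dist (lost_mass t / (t0 - t)) edge < \<epsilon>) (at_left t0)"
  proof eventually_elim
    case (elim t)
    have close: "\<bar>?w y - edge\<bar> \<le> \<epsilon> / 2" if "t < y" "y \<le> t0" for y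
      using b(2)[of y] that elim \<epsilon> by (cases "y = t0") (auto simp: dist_real_def)
    let ?K = "\<bar>edge\<bar> + \<epsilon>"
    have K: "\<bar>edge - \<epsilon> / 2\<bar> \<le> ?K" "\<bar>edge + \<epsilon> / 2\<bar> \<le> ?K" using \<epsilon> by linarith+
    have w: "edge - \<epsilon> / 2 \<le> ?w y" "?w y \<le> edge + \<epsilon> / 2" "\<bar>?w y\<bar> \<le> ?K" if "t < y" "y \<le> t0" for y
      using close[OF that] \<epsilon> by linarith+
    have "window_integral (\<lambda>_. edge - \<epsilon> / 2) t t0 \<le> window_integral ?w t t0"
      by (rule window_integral_mono[where K = ?K]) (use w K in auto)
    moreover have "window_integral ?w t t0 \<le> window_integral (\<lambda>_. edge + \<epsilon> / 2) t t0"
      by (rule window_integral_mono[where K = ?K]) (use w K in auto)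
    ultimately have "(t0 - t) * (edge - \<epsilon> / 2) \<le> lost_mass t" "lost_mass t \<le> (t0 - t) * (edge + \<epsilon> / 2)"
      using elim by (auto simp: window_integral_const lost_mass_window)
    then have "edge - \<epsilon> / 2 \<le> lost_mass t / (t0 - t)" "lost_mass t / (t0 - t) \<le> edge + \<epsilon> / 2"
      using elim by (auto simp: pos_le_divide_eq pos_divide_le_eq mult.commute)
    then show ?case using \<epsilon> by (simp add: dist_real_def abs_less_iff)
  qed
qed

lemma at_left_gap_tendsto: "((\<lambda>t. t0 - t) \<longlongrightarrow> 0) (at_left t0)"
proof -
  have "((\<lambda>t. t0 - t) \<longlongrightarrow> t0 - t0) (at_left t0)" by (intro tendsto_intros)
  then show ?thesis by simp
qed

lemma eventually_below: "eventually (\<lambda>t. 0 < t \<and> t < t0) (at_left t0)"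
  using t0_pos by (auto simp: eventually_at_left_field intro: exI[of _ 0])

lemma lost_mass_tendsto: "(lost_mass \<longlongrightarrow> 0) (at_left t0)"
proof -
  have "((\<lambda>t. lost_mass t / (t0 - t) * (t0 - t)) \<longlongrightarrow> edge * 0) (at_left t0)"
    by (intro tendsto_mult lost_mass_rate at_left_gap_tendsto)
  then have "((\<lambda>t. lost_mass t / (t0 - t) * (t0 - t)) \<longlongrightarrow> 0) (at_left t0)" by simp
  then show ?thesis
    by (rule Lim_transform_eventually) (use eventually_below in eventually_elim, simp)
qed

lemma tilt_mean_tendsto: "(tilt_mean \<gamma> \<longlongrightarrow> B) (at_left t0)"
proof (rule tendsto_sandwich)
  show "eventually (\<lambda>t. B - t0 * lost_mass t \<le> tilt_mean \<gamma> t) (at_left t0)"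
    using eventually_below by eventually_elim (intro tilt_mean_bounds, simp)
  show "eventually (\<lambda>t. tilt_mean \<gamma> t \<le> B) (at_left t0)"
    using eventually_below by eventually_elim (intro tilt_mean_bounds, simp)
  have "((\<lambda>t. B - t0 * lost_mass t) \<longlongrightarrow> B - t0 * 0) (at_left t0)"
    by (intro tendsto_intros lost_mass_tendsto)
  then show "((\<lambda>t. B - t0 * lost_mass t) \<longlongrightarrow> B) (at_left t0)" by simp
qed auto

lemma tilt_mass_0_tendsto: "(tilt_mass 0 \<longlongrightarrow> tilt_mass 0 t0) (at_left t0)"
proof (rule tendsto_sandwich)
  show "eventually (\<lambda>t. tilt_mass 0 t0 - lost_mass t \<le> tilt_mass 0 t) (at_left t0)"
    using eventually_below by eventually_elim (intro tilt_mass_0_bounds, simp)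
  show "eventually (\<lambda>t. tilt_mass 0 t \<le> tilt_mass 0 t0) (at_left t0)"
    using eventually_below by eventually_elim (intro tilt_mass_0_bounds, simp)
  have "((\<lambda>t. tilt_mass 0 t0 - lost_mass t) \<longlongrightarrow> tilt_mass 0 t0 - 0) (at_left t0)"
    by (intro tendsto_intros lost_mass_tendsto)
  then show "((\<lambda>t. tilt_mass 0 t0 - lost_mass t) \<longlongrightarrow> tilt_mass 0 t0) (at_left t0)" by simp
qed auto

lemma density_near_edge:
  obtains a b where "0 < a" "a < b" "b < t0" "\<And>y. a \<le> y \<Longrightarrow> y < t0 \<Longrightarrow> g t0 / 2 \<le> g y"
proof -
  have "eventually (\<lambda>y. g t0 / 2 < g y) (at_left t0)"
    using g_pos by (intro order_tendstoD(1)[OF g_left]) auto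
  then obtain d where d: "d < t0" "\<And>y. d < y \<Longrightarrow> y < t0 \<Longrightarrow> g t0 / 2 < g y"
    by (auto simp: eventually_at_left_field)
  obtain a where a: "max 0 d < a" "a < t0" using d(1) t0_pos dense[of "max 0 d" t0] by auto
  obtain b where b: "a < b" "b < t0" using dense[of a t0] a by auto
  show ?thesis
  proof (rule that[of a b])
    show "g t0 / 2 \<le> g y" if "a \<le> y" "y < t0" for y
      using d(2)[of y] that a by simp
  qed (use a b in auto)
qed

text \<open>
  The interval \<open>[a, b]\<close> and the constant \<open>g t0 / 2\<close> serve all task times in \<open>[b, t0]\<close> at once; this is the source
  of uniformity.
\<close>

lemma minorized_tilt:
  assumes ab: "0 < a" "a < b" "b < t0" "\<And>y. a \<le> y \<Longrightarrow> y < t0 \<Longrightarrow> g t0 / 2 \<le> g y"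
    and t: "b \<le> t" "t \<le> t0" and \<theta>: "0 < \<theta>" "tilt_mass \<theta> t = 1"
  shows "minorized_renewal_kernel (tilt \<theta> t) t \<theta> a b (g t0 / 2)"
proof (intro minorized_renewal_kernel.intro minorized_renewal_kernel_axioms.intro tilt_kernel)
  show "tilt_mass 0 t < 1" using tilt_mass_0_bounds(2)[OF t(2)] tilt_mass_0 by simp
  show "g t0 / 2 \<le> tilt \<theta> t y" if "a \<le> y" "y \<le> b" for y
  proof -
    have "1 * (g t0 / 2) \<le> exp (\<theta> * y) * g y"
      using that ab \<theta> g_pos by (intro mult_mono) auto
    then show ?thesis using that ab t by (simp add: tilt_def)
  qed
qed (use assms g_pos in auto)

lemma B_pos: "0 < B"
proof -
  obtain a b where ab: "0 < a" "a < b" "b < t0" "\<And>y. a \<le> y \<Longrightarrow> y < t0 \<Longrightarrow> g t0 / 2 \<le> g y"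
    by (rule density_near_edge) blast
  interpret minorized_renewal_kernel "tilt \<gamma> t0" t0 \<gamma> a b "g t0 / 2"
    by (rule minorized_tilt) (use ab \<gamma>_pos tilt_mass_\<gamma> in auto)
  show ?thesis using mean_pos by (simp add: mean_def tilt_mean_def)
qed

definition exponent :: "real \<Rightarrow> real" where
  "exponent t = (SOME \<theta>. \<gamma> \<le> \<theta> \<and> \<theta> \<le> \<gamma> + lost_mass t / tilt_mean \<gamma> t \<and> tilt_mass \<theta> t = 1)"

lemma exponent:
  assumes "t \<le> t0" "0 < tilt_mean \<gamma> t"
  shows "\<gamma> \<le> exponent t" "exponent t \<le> \<gamma> + lost_mass t / tilt_mean \<gamma> t" "tilt_mass (exponent t) t = 1"
proof -
  have "\<exists>\<theta>. \<gamma> \<le> \<theta> \<and> \<theta> \<le> \<gamma> + lost_mass t / tilt_mean \<gamma> t \<and> tilt_mass \<theta> t = 1"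
    by (rule exponent_exists[OF assms]) blast
  from someI_ex[OF this] show "\<gamma> \<le> exponent t" "exponent t \<le> \<gamma> + lost_mass t / tilt_mean \<gamma> t"
    "tilt_mass (exponent t) t = 1"
    unfolding exponent_def by blast+
qed

lemma eventually_exponent: "eventually (\<lambda>t. 0 < t \<and> t < t0 \<and> 0 < tilt_mean \<gamma> t) (at_left t0)"
  using eventually_below order_tendstoD(1)[OF tilt_mean_tendsto B_pos] by eventually_elim auto

lemma exponent_tendsto: "(exponent \<longlongrightarrow> \<gamma>) (at_left t0)"
proof (rule tendsto_sandwich)
  show "eventually (\<lambda>t. \<gamma> \<le> exponent t) (at_left t0)"
    using eventually_exponent by eventually_elim (intro exponent, auto)
  show "eventually (\<lambda>t. exponent t \<le> \<gamma> + lost_mass t / tilt_mean \<gamma> t) (at_left t0)"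
    using eventually_exponent by eventually_elim (intro exponent, auto)
  have "((\<lambda>t. \<gamma> + lost_mass t / tilt_mean \<gamma> t) \<longlongrightarrow> \<gamma> + 0 / B) (at_left t0)"
    using B_pos by (intro tendsto_intros lost_mass_tendsto tilt_mean_tendsto) auto
  then show "((\<lambda>t. \<gamma> + lost_mass t / tilt_mean \<gamma> t) \<longlongrightarrow> \<gamma>) (at_left t0)" by simp
qed auto

text \<open>
  Both bounds on \<open>exponent t - \<gamma>\<close> are \<open>lost_mass t / B\<close> up to factors tending to \<open>1\<close>.
\<close>

lemma exponent_rate: "((\<lambda>t. (exponent t - \<gamma>) / (t0 - t)) \<longlongrightarrow> edge / B) (at_left t0)"
proof (rule tendsto_sandwich)
  let ?r = "\<lambda>t. lost_mass t / (t0 - t)" and ?e = "\<lambda>t. exp ((exponent t - \<gamma>) * t0)"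
  show "eventually (\<lambda>t. ?r t / (?e t * tilt_mean \<gamma> t) \<le> (exponent t - \<gamma>) / (t0 - t)) (at_left t0)"
    using eventually_exponent
  proof eventually_elim
    case (elim t)
    have "lost_mass t \<le> (exponent t - \<gamma>) * ?e t * tilt_mean \<gamma> t"
      using elim by (intro exponent_lower_bound exponent) auto
    then have "lost_mass t / (?e t * tilt_mean \<gamma> t) \<le> exponent t - \<gamma>"
      using elim by (simp add: pos_divide_le_eq mult.assoc)
    then have "lost_mass t / (?e t * tilt_mean \<gamma> t) / (t0 - t) \<le> (exponent t - \<gamma>) / (t0 - t)"
      using elim by (intro divide_right_mono) auto
    then show ?case by (simp add: mult.commute)
  qed
  show "eventually (\<lambda>t. (exponent t - \<gamma>) / (t0 - t) \<le> ?r t / tilt_mean \<gamma> t) (at_left t0)"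
    using eventually_exponent
  proof eventually_elim
    case (elim t)
    then have "exponent t \<le> \<gamma> + lost_mass t / tilt_mean \<gamma> t" by (intro exponent) auto
    then have "(exponent t - \<gamma>) / (t0 - t) \<le> lost_mass t / tilt_mean \<gamma> t / (t0 - t)"
      using elim by (intro divide_right_mono) auto
    then show ?case by (simp add: mult.commute)
  qed
  have "((\<lambda>t. ?r t / (?e t * tilt_mean \<gamma> t)) \<longlongrightarrow> edge / (exp ((\<gamma> - \<gamma>) * t0) * B)) (at_left t0)"
    using B_pos by (intro tendsto_intros lost_mass_rate tilt_mean_tendsto exponent_tendsto) auto
  then show "((\<lambda>t. ?r t / (?e t * tilt_mean \<gamma> t)) \<longlongrightarrow> edge / B) (at_left t0)" by simp
  show "((\<lambda>t. ?r t / tilt_mean \<gamma> t) \<longlongrightarrow> edge / B) (at_left t0)"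
    using B_pos by (intro tendsto_intros lost_mass_rate tilt_mean_tendsto) auto
qed

text \<open>
  The Cramer-Lundberg constant for task time \<open>t\<close>: initial flow divided by the mean of the tilted density.
\<close>

definition prefactor :: "real \<Rightarrow> real" where
  "prefactor t = (1 - tilt_mass 0 t) / (exponent t * tilt_mean (exponent t) t)"

lemma prefactor_tendsto:
  "(prefactor \<longlongrightarrow> (1 - tilt_mass 0 t0) / (\<gamma> * B)) (at_left t0)"
proof -
  have "((\<lambda>t. tilt_mean (exponent t) t) \<longlongrightarrow> B) (at_left t0)"
  proof (rule tendsto_sandwich)
    show "eventually (\<lambda>t. tilt_mean \<gamma> t \<le> tilt_mean (exponent t) t) (at_left t0)"
      using eventually_exponent by eventually_elim (intro tilt_mean_exponent_bounds exponent, auto)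
    show "eventually (\<lambda>t. tilt_mean (exponent t) t \<le> exp ((exponent t - \<gamma>) * t0) * tilt_mean \<gamma> t) (at_left t0)"
      using eventually_exponent by eventually_elim (intro tilt_mean_exponent_bounds exponent, auto)
    have "((\<lambda>t. exp ((exponent t - \<gamma>) * t0) * tilt_mean \<gamma> t) \<longlongrightarrow> exp ((\<gamma> - \<gamma>) * t0) * B) (at_left t0)"
      by (intro tendsto_intros tilt_mean_tendsto exponent_tendsto)
    then show "((\<lambda>t. exp ((exponent t - \<gamma>) * t0) * tilt_mean \<gamma> t) \<longlongrightarrow> B) (at_left t0)" by simp
  qed (rule tilt_mean_tendsto)
  then show ?thesis
    unfolding prefactor_def[abs_def]
    using \<gamma>_pos B_pos by (intro tendsto_intros tilt_mass_0_tendsto exponent_tendsto) auto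
qed

text \<open>
  Near \<open>t0\<close> the minorization, the lower bound \<open>l * (\<kappa> * a)\<close> for the mean and the bound \<open>t0\<close> for the window length
  do not depend on \<open>t\<close>, hence neither do the contraction factor \<open>1 - \<theta>\<close> and the time step \<open>L\<close>.
\<close>

lemma uniform_cramer_lundberg:
  obtains t1 where "0 < t1" "t1 < t0"
    "\<And>t. t1 \<le> t \<Longrightarrow> t < t0 \<Longrightarrow> 0 < tilt_mean \<gamma> t"
    "\<And>\<epsilon>. 0 < \<epsilon> \<Longrightarrow> \<exists>z0. \<forall>t z. t1 \<le> t \<and> t < t0 \<and> z0 \<le> z \<longrightarrow>
        \<bar>tilted_tail (exponent t) t z - prefactor t\<bar> \<le> \<epsilon>"
proof -
  obtain a b where ab: "0 < a" "a < b" "b < t0" "\<And>y. a \<le> y \<Longrightarrow> y < t0 \<Longrightarrow> g t0 / 2 \<le> g y"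
    by (rule density_near_edge) blast
  obtain d where d: "d < t0" "\<And>t. d < t \<Longrightarrow> t < t0 \<Longrightarrow> 0 < tilt_mean \<gamma> t"
    using eventually_exponent by (auto simp: eventually_at_left_field)
  obtain t1 where t1: "max b d < t1" "t1 < t0" using ab(3) d(1) dense[of "max b d" t0] by auto
  define \<kappa> where "\<kappa> = g t0 / 2"
  define l where "l = b - a"
  obtain n :: nat where n: "2 * t0 / l \<le> n" using real_arch_simple by blast
  have l: "0 < l" using ab by (simp add: l_def)
  have \<kappa>: "0 < \<kappa>" using g_pos by (simp add: \<kappa>_def)
  have n': "2 * t0 \<le> n * l" using n l by (simp add: pos_divide_le_eq)
  have n0: "0 < n" using n' t0_pos l by (cases n) auto
  define \<rho> where "\<rho> = \<kappa> / n * (\<kappa> * l / 4) ^ n"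
  define \<theta> where "\<theta> = min 1 (l * (\<kappa> * a) * \<rho>)"
  have \<rho>: "0 < \<rho>" using \<kappa> l n0 by (simp add: \<rho>_def)
  have \<theta>: "0 < \<theta>" "\<theta> \<le> 1" using \<rho> \<kappa> l ab by (auto simp: \<theta>_def)
  define L where "L = (n + 1) * (a + l) + 2 * t0"
  have conv: "\<bar>tilted_tail (exponent t) t z - prefactor t\<bar> \<le> (1 - \<theta>) ^ i"
    if t: "t1 \<le> t" "t < t0" and z: "i * L \<le> z" for t z and i :: nat
  proof -
    have pos: "0 < tilt_mean \<gamma> t" using d(2) t t1 by auto
    note e = exponent[OF less_imp_le[OF t(2)] pos]
    have epos: "0 < exponent t" using e(1) \<gamma>_pos by simp
    have tpos: "0 < t" using t t1 ab by auto
    have m0: "tilt_mass 0 t < 1" using tilt_mass_0_bounds(2)[of t] t tilt_mass_0 by simp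
    interpret minorized_renewal_kernel "tilt (exponent t) t" t "exponent t" a b \<kappa>
      unfolding \<kappa>_def by (rule minorized_tilt) (use ab t t1 e epos in auto)
    have lim: "limit (tilted_tail (exponent t) t) = prefactor t"
      unfolding limit_def prefactor_def initial_flow[OF epos tpos e(3) m0]
      by (simp add: mean_def tilt_mean_def)
    have "\<theta> \<le> l * (\<kappa> * a) * \<rho>" by (simp add: \<theta>_def)
    also have "\<dots> \<le> mean * \<rho>"
      using mean_lower_bound \<rho> by (intro mult_right_mono) (auto simp: l_def)
    finally have \<theta>': "\<theta> \<le> mean * \<rho>" .
    have "i * ((n + 1) * (a + l) + 2 * t) \<le> i * L"
      using t by (intro mult_left_mono) (auto simp: L_def)
    with z have z': "i * ((n + 1) * (a + l) + 2 * t) \<le> z" by simp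
    show ?thesis
      unfolding lim[symmetric]
    proof (rule convergence[folded l_def, of _ n])
      show "solution (tilted_tail (exponent t) t)"
        by (rule tilted_tail_solution[OF epos tpos e(3) m0])
      show "tilted_tail (exponent t) t z \<le> 1" for z
        by (rule lundberg_bound[OF epos tpos e(3) m0])
      show "2 * t \<le> n * l" using n' t by simp
      show "\<theta> \<le> mean * (\<kappa> / n * (\<kappa> * l / 4) ^ n)" using \<theta>' by (simp add: \<rho>_def)
    qed (use z' \<theta> tilted_tail_nonneg in auto)
  qed
  show ?thesis
  proof (rule that[of t1])
    show "\<exists>z0. \<forall>t z. t1 \<le> t \<and> t < t0 \<and> z0 \<le> z \<longrightarrow>
        \<bar>tilted_tail (exponent t) t z - prefactor t\<bar> \<le> \<epsilon>" if \<epsilon>: "0 < \<epsilon>" for \<epsilon>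
    proof -
      obtain i where "(1 - \<theta>) ^ i < \<epsilon>"
        using real_arch_pow_inv[OF \<epsilon>, of "1 - \<theta>"] \<theta> by auto
      then show ?thesis using conv[of _ i] by (intro exI[of _ "i * L"]) force
    qed
  qed (use t1 ab d in auto)
qed

end

section \<open>Integration over the task time\<close>

text \<open>
  Rescaled Euler integral, in the form in which it appears as the limit and as the dominating function.
\<close>

lemma has_bochner_integral_Gamma:
  assumes \<alpha>: "- 1 < \<alpha>" and c: "0 < (c :: real)"
  shows "has_bochner_integral lborel (\<lambda>v. if 0 < v then v powr \<alpha> * exp (- c * v) else 0)
           (Gamma (\<alpha> + 1) / c powr (\<alpha> + 1))"
proof -
  let ?h = "\<lambda>v::real. indicator {0..} v * v powr \<alpha> / exp v"
  have "has_bochner_integral lborel ?h (Gamma (\<alpha> + 1))"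
  proof (rule has_bochner_integral_nn_integral)
    show "0 \<le> Gamma (\<alpha> + 1)" using \<alpha> by (intro less_imp_le Gamma_real_pos) auto
    show "(\<integral>\<^sup>+v. ennreal (?h v) \<partial>lborel) = ennreal (Gamma (\<alpha> + 1))"
      using Gamma_conv_nn_integral_real[of "\<alpha> + 1"] \<alpha> by simp
  qed simp_all
  then have "has_bochner_integral lborel (\<lambda>v. ?h (0 + c * v)) (Gamma (\<alpha> + 1) /\<^sub>R \<bar>c\<bar>)"
    using c by (subst (asm) lborel_has_bochner_integral_real_affine_iff[of c _ _ 0]) auto
  then have "has_bochner_integral lborel (\<lambda>v. c powr (- \<alpha>) * ?h (0 + c * v)) (c powr (- \<alpha>) * (Gamma (\<alpha> + 1) /\<^sub>R \<bar>c\<bar>))"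
    by (rule has_bochner_integral_mult_right)
  also have "c powr (- \<alpha>) * (Gamma (\<alpha> + 1) /\<^sub>R \<bar>c\<bar>) = Gamma (\<alpha> + 1) / c powr (\<alpha> + 1)"
    using c by (simp add: powr_add powr_minus field_simps)
  also have "(\<lambda>v. c powr (- \<alpha>) * ?h (0 + c * v)) = (\<lambda>v. if 0 < v then v powr \<alpha> * exp (- c * v) else 0)"
    using c by (auto simp: fun_eq_iff indicator_def powr_mult powr_minus exp_minus zero_le_mult_iff field_simps)
  finally show ?thesis .
qed

locale restart_edge =
  restart_model M T U f g + tilted_failure_law g t0 \<gamma>
  for M :: "'a measure" and T U f g t0 \<gamma> +
  fixes A \<alpha> :: real
  assumes A_pos: "0 < A" and \<alpha>_nonneg: "0 \<le> \<alpha>"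
    and f_edge: "((\<lambda>t. f t / (t0 - t) powr \<alpha>) \<longlongrightarrow> A) (at_left t0)"
    and f_beyond: "AE t in lborel. t0 < t \<longrightarrow> f t = 0"
begin

text \<open>
  \<open>rate\<close> is the slope of the exponent at the endpoint and \<open>C\<^sub>0\<close> the limit of the prefactor.
\<close>

abbreviation "rate \<equiv> edge / B"

abbreviation "C\<^sub>0 \<equiv> (1 - tilt_mass 0 t0) / (\<gamma> * B)"

lemma rate_pos: "0 < rate"
  using g_pos B_pos by simp

lemma lost_tail_borel [measurable]: "(\<lambda>t. lost_tail t (x - t)) \<in> borel_measurable borel"
  using measurable_compose[OF _ measurable_lost_tail, of "\<lambda>t. (t, x - t)" borel] by simp

lemma f_integrable: "integrable lborel f" and f_total: "(LINT t|lborel. f t) = 1"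
proof -
  have "emeasure (distr M borel T) UNIV = 1"
    using emeasure_space_1 by (subst emeasure_distr) auto
  then have *: "(\<integral>\<^sup>+t. ennreal (f t) \<partial>lborel) = 1"
    by (simp add: distr_T emeasure_density)
  have "has_bochner_integral lborel f 1"
    by (rule has_bochner_integral_nn_integral) (use * f_nonneg in auto)
  then show "integrable lborel f" "(LINT t|lborel. f t) = 1"
    by (auto simp: has_bochner_integral_iff)
qed

text \<open>
  A left neighbourhood of the endpoint on which the density, the exponent and the convergence are
  under control simultaneously.  The lower bound for the exponent makes the dominating function
  integrable, and at \<open>t2\<close> itself it makes the contribution of the shorter tasks negligible.
\<close>

lemma edge_window:
  obtains t2 where "0 < t2" "t2 < t0"
    "\<And>t. t2 \<le> t \<Longrightarrow> t < t0 \<Longrightarrow> 0 < tilt_mean \<gamma> t \<and> f t \<le> 2 * A * (t0 - t) powr \<alpha>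
        \<and> \<gamma> + rate / 2 * (t0 - t) \<le> exponent t"
    "\<And>\<epsilon>. 0 < \<epsilon> \<Longrightarrow> \<exists>z0. \<forall>t z. t2 \<le> t \<and> t < t0 \<and> z0 \<le> z \<longrightarrow>
        \<bar>tilted_tail (exponent t) t z - prefactor t\<bar> \<le> \<epsilon>"
proof -
  obtain t1 where t1: "0 < t1" "t1 < t0"
    "\<And>t. t1 \<le> t \<Longrightarrow> t < t0 \<Longrightarrow> 0 < tilt_mean \<gamma> t"
    "\<And>\<epsilon>. 0 < \<epsilon> \<Longrightarrow> \<exists>z0. \<forall>t z. t1 \<le> t \<and> t < t0 \<and> z0 \<le> z \<longrightarrow>
        \<bar>tilted_tail (exponent t) t z - prefactor t\<bar> \<le> \<epsilon>"
    by (rule uniform_cramer_lundberg) blast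
  have "eventually (\<lambda>t. f t / (t0 - t) powr \<alpha> < 2 * A) (at_left t0)"
    using A_pos by (intro order_tendstoD(2)[OF f_edge]) auto
  moreover have "eventually (\<lambda>t. rate / 2 < (exponent t - \<gamma>) / (t0 - t)) (at_left t0)"
    using rate_pos by (intro order_tendstoD(1)[OF exponent_rate]) auto
  ultimately have "eventually (\<lambda>t. f t \<le> 2 * A * (t0 - t) powr \<alpha> \<and> \<gamma> + rate / 2 * (t0 - t) \<le> exponent t) (at_left t0)"
    using eventually_below
  proof eventually_elim
    case (elim t)
    have "0 < (t0 - t) powr \<alpha>" using elim by simp
    then have "f t \<le> 2 * A * (t0 - t) powr \<alpha>" using elim(1) by (simp add: pos_divide_less_eq)
    moreover have "rate / 2 * (t0 - t) < exponent t - \<gamma>"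
      using elim(2,3) by (simp only: pos_less_divide_eq diff_gt_0_iff_gt)
    ultimately show ?case by simp
  qed
  then obtain d where d: "d < t0" "\<And>t. d < t \<Longrightarrow> t < t0 \<Longrightarrow>
      f t \<le> 2 * A * (t0 - t) powr \<alpha> \<and> \<gamma> + rate / 2 * (t0 - t) \<le> exponent t"
    by (auto simp: eventually_at_left_field)
  obtain t2 where t2: "max t1 d < t2" "t2 < t0" using t1 d dense[of "max t1 d" t0] by auto
  show ?thesis
  proof (rule that[of t2])
    show "\<exists>z0. \<forall>t z. t2 \<le> t \<and> t < t0 \<and> z0 \<le> z \<longrightarrow>
        \<bar>tilted_tail (exponent t) t z - prefactor t\<bar> \<le> \<epsilon>" if \<epsilon>: "0 < \<epsilon>" for \<epsilon>
    proof -
      obtain z0 where z0: "\<And>t z. t1 \<le> t \<and> t < t0 \<and> z0 \<le> z \<longrightarrow>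
        \<bar>tilted_tail (exponent t) t z - prefactor t\<bar> \<le> \<epsilon>"
        using t1(4)[OF \<epsilon>] by blast
      then show ?thesis using t2 by (intro exI[of _ z0]) auto
    qed
    show "0 < tilt_mean \<gamma> t \<and> f t \<le> 2 * A * (t0 - t) powr \<alpha> \<and> \<gamma> + rate / 2 * (t0 - t) \<le> exponent t"
      if "t2 \<le> t" "t < t0" for t
      using d(2)[of t] t1(3)[of t] t2 that by auto
  qed (use t1 t2 in auto)
qed

lemma tilted_tail_exp_split:
  "exp (\<gamma> * x) * lost_tail t (x - t) = tilted_tail \<theta> t (x - t) * exp (\<gamma> * t - (\<theta> - \<gamma>) * (x - t))"
proof -
  have "exp (\<gamma> * x) = exp (\<theta> * (x - t)) * exp (\<gamma> * t - (\<theta> - \<gamma>) * (x - t))"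
    by (simp add: exp_add[symmetric] algebra_simps)
  then show ?thesis by (simp add: tilted_tail_def)
qed

lemma edge_rescale:
  assumes "0 < x" "0 < v"
  shows "x powr \<alpha> * f (t0 - v / x) = v powr \<alpha> * (f (t0 - v / x) / (t0 - (t0 - v / x)) powr \<alpha>)"
  using assms by (simp add: powr_divide)

text \<open>
  With \<open>t = t0 - v / x\<close> the three factors are treated separately: the density through its assumed asymptotics,
  the tilted tail through uniform convergence, as \<open>t\<close> moves with \<open>x\<close>, and the remaining exponential through
  the convergence of \<open>(exponent t - \<gamma>) * (x - t)\<close> to \<open>rate * v\<close>.
\<close>

lemma scaled_pointwise:
  assumes t2: "t2 < t0"
    "\<And>\<epsilon>. 0 < \<epsilon> \<Longrightarrow> \<exists>z0. \<forall>t z. t2 \<le> t \<and> t < t0 \<and> z0 \<le> z \<longrightarrow>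
        \<bar>tilted_tail (exponent t) t z - prefactor t\<bar> \<le> \<epsilon>"
    and v: "0 < v"
  shows "((\<lambda>x. x powr \<alpha> * exp (\<gamma> * x) * (f (t0 - v / x) * lost_tail (t0 - v / x) (x - (t0 - v / x))))
     \<longlongrightarrow> A * C\<^sub>0 * exp (\<gamma> * t0) * (v powr \<alpha> * exp (- rate * v))) at_top"
proof -
  define \<tau> where "\<tau> x = t0 - v / x" for x
  have v0: "((\<lambda>x. v / x) \<longlongrightarrow> 0) at_top"
    by (intro tendsto_divide_0[OF tendsto_const] filterlim_at_top_imp_at_infinity filterlim_ident)
  have \<tau>_lim: "(\<tau> \<longlongrightarrow> t0) at_top"
  proof -
    have "(\<tau> \<longlongrightarrow> t0 - 0) at_top" unfolding \<tau>_def by (intro tendsto_intros v0)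
    then show ?thesis by simp
  qed
  have x_pos: "eventually (\<lambda>x::real. 0 < x) at_top" by (rule eventually_gt_at_top)
  have \<tau>_less: "eventually (\<lambda>x. \<tau> x < t0) at_top"
    using x_pos by eventually_elim (use v in \<open>simp add: \<tau>_def\<close>)
  have \<tau>_left: "filterlim \<tau> (at_left t0) at_top"
    using \<tau>_lim \<tau>_less by (auto simp: filterlim_at intro: eventually_mono)
  have \<tau>_ge: "eventually (\<lambda>x. t2 < \<tau> x) at_top"
    by (rule order_tendstoD(1)[OF \<tau>_lim t2(1)])
  have x\<tau>: "filterlim (\<lambda>x. x - \<tau> x) at_top at_top"
  proof (rule filterlim_at_top_mono)
    show "filterlim (\<lambda>x. - t0 + x) at_top (at_top :: real filter)"
      by (intro filterlim_tendsto_add_at_top[OF tendsto_const] filterlim_ident)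
    show "eventually (\<lambda>x. - t0 + x \<le> x - \<tau> x) at_top"
      using \<tau>_less by eventually_elim simp
  qed
  have "((\<lambda>x. tilted_tail (exponent (\<tau> x)) (\<tau> x) (x - \<tau> x) - prefactor (\<tau> x)) \<longlongrightarrow> 0) at_top"
  proof (rule tendstoI)
    fix \<epsilon> :: real assume "0 < \<epsilon>"
    then obtain z0 where z0: "\<forall>t z. t2 \<le> t \<and> t < t0 \<and> z0 \<le> z \<longrightarrow>
        \<bar>tilted_tail (exponent t) t z - prefactor t\<bar> \<le> \<epsilon> / 2"
      using t2(2)[of "\<epsilon> / 2"] by auto
    have "eventually (\<lambda>x. z0 \<le> x - \<tau> x) at_top"
      using x\<tau> by (auto simp: filterlim_at_top)
    then show "eventually (\<lambda>x. dist (tilted_tail (exponent (\<tau> x)) (\<tau> x) (x - \<tau> x) - prefactor (\<tau> x)) 0 < \<epsilon>) at_top"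
      using \<tau>_ge \<tau>_less
    proof eventually_elim
      case (elim x)
      then have "\<bar>tilted_tail (exponent (\<tau> x)) (\<tau> x) (x - \<tau> x) - prefactor (\<tau> x)\<bar> \<le> \<epsilon> / 2"
        using z0 by auto
      then show ?case using \<open>0 < \<epsilon>\<close> by (simp add: dist_real_def)
    qed
  qed
  from tendsto_add[OF this filterlim_compose[OF prefactor_tendsto \<tau>_left]]
  have tail: "((\<lambda>x. tilted_tail (exponent (\<tau> x)) (\<tau> x) (x - \<tau> x)) \<longlongrightarrow> C\<^sub>0) at_top"
    by simp
  have "((\<lambda>x. (exponent (\<tau> x) - \<gamma>) / (t0 - \<tau> x) * (v - v / x * \<tau> x)) \<longlongrightarrow> rate * (v - 0 * t0)) at_top"
    by (intro tendsto_intros filterlim_compose[OF exponent_rate \<tau>_left] v0 \<tau>_lim)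
  moreover have "eventually (\<lambda>x. (exponent (\<tau> x) - \<gamma>) / (t0 - \<tau> x) * (v - v / x * \<tau> x)
      = (exponent (\<tau> x) - \<gamma>) * (x - \<tau> x)) at_top"
    using x_pos
  proof eventually_elim
    case (elim x)
    have "t0 - \<tau> x = v / x" by (simp add: \<tau>_def)
    moreover have "v - v / x * \<tau> x = v / x * (x - \<tau> x)" using elim by (simp add: right_diff_distrib)
    ultimately show ?case using elim v by simp
  qed
  ultimately have ex: "((\<lambda>x. (exponent (\<tau> x) - \<gamma>) * (x - \<tau> x)) \<longlongrightarrow> rate * v) at_top"
    by (auto elim: Lim_transform_eventually)
  have "((\<lambda>x. v powr \<alpha> * (f (\<tau> x) / (t0 - \<tau> x) powr \<alpha>) *
      (tilted_tail (exponent (\<tau> x)) (\<tau> x) (x - \<tau> x) * exp (\<gamma> * \<tau> x - (exponent (\<tau> x) - \<gamma>) * (x - \<tau> x))))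
      \<longlongrightarrow> v powr \<alpha> * A * (C\<^sub>0 * exp (\<gamma> * t0 - rate * v))) at_top"
    by (intro tendsto_mult tendsto_const tendsto_exp tendsto_diff filterlim_compose[OF f_edge \<tau>_left]
        tail ex \<tau>_lim)
  moreover have "v powr \<alpha> * A * (C\<^sub>0 * exp (\<gamma> * t0 - rate * v))
      = A * C\<^sub>0 * exp (\<gamma> * t0) * (v powr \<alpha> * exp (- rate * v))"
    by (simp add: exp_diff exp_minus field_simps)
  moreover have "eventually (\<lambda>x. v powr \<alpha> * (f (\<tau> x) / (t0 - \<tau> x) powr \<alpha>) *
      (tilted_tail (exponent (\<tau> x)) (\<tau> x) (x - \<tau> x) * exp (\<gamma> * \<tau> x - (exponent (\<tau> x) - \<gamma>) * (x - \<tau> x)))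
      = x powr \<alpha> * exp (\<gamma> * x) * (f (t0 - v / x) * lost_tail (t0 - v / x) (x - (t0 - v / x)))) at_top"
    using x_pos
  proof eventually_elim
    case (elim x)
    show ?case
      unfolding tilted_tail_exp_split[symmetric] \<tau>_def edge_rescale[OF elim v, symmetric]
      by (simp only: mult_ac)
  qed
  ultimately show ?thesis
    by (simp only:) (rule Lim_transform_eventually)
qed

text \<open>
  Lundberg's inequality replaces the limit of the tilted tail by the bound \<open>1\<close>.  The rate loses a factor \<open>2\<close>
  from the exponent bound and another one from \<open>x - t \<ge> x / 2\<close>.
\<close>

lemma scaled_dominated:
  assumes t2: "0 < t2" "t2 < t0"
    and bounds: "\<And>t. t2 \<le> t \<Longrightarrow> t < t0 \<Longrightarrow> 0 < tilt_mean \<gamma> t \<and> f t \<le> 2 * A * (t0 - t) powr \<alpha>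
        \<and> \<gamma> + rate / 2 * (t0 - t) \<le> exponent t"
    and x: "2 * t0 \<le> x" and v: "0 < v" "v < (t0 - t2) * x"
  shows "x powr \<alpha> * exp (\<gamma> * x) * (f (t0 - v / x) * lost_tail (t0 - v / x) (x - (t0 - v / x)))
    \<le> 2 * A * exp (\<gamma> * t0) * (v powr \<alpha> * exp (- (rate / 4) * v))"
proof -
  define t where "t = t0 - v / x"
  have x0: "0 < x" using x t0_pos by simp
  have t: "t2 \<le> t" "t < t0" using v x0 by (auto simp: t_def field_simps)
  have gap: "t0 - t = v / x" by (simp add: t_def)
  note b = bounds[OF t]
  have e: "\<gamma> \<le> exponent t" "tilt_mass (exponent t) t = 1" using exponent[of t] b t by auto
  have m0: "tilt_mass 0 t < 1" using tilt_mass_0_bounds(2)[of t] t tilt_mass_0 by simp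
  have tail_le: "tilted_tail (exponent t) t (x - t) \<le> 1"
    by (rule lundberg_bound) (use e m0 t t2 \<gamma>_pos in auto)
  have "x powr \<alpha> * f t \<le> x powr \<alpha> * (2 * A * (v / x) powr \<alpha>)"
    using b by (intro mult_left_mono) (auto simp: gap)
  also have "\<dots> = 2 * A * v powr \<alpha>" using x0 v by (simp add: powr_divide)
  finally have f_le: "x powr \<alpha> * f t \<le> 2 * A * v powr \<alpha>" .
  have "rate / 4 * v = rate / 2 * (v / x) * (x / 2)" using x0 by simp
  also have "\<dots> \<le> (exponent t - \<gamma>) * (x - t)"
    using b x t t2 rate_pos v x0 by (intro mult_mono) (auto simp: gap intro: e(1))
  finally have rv: "rate / 4 * v \<le> (exponent t - \<gamma>) * (x - t)" .
  have "exp (\<gamma> * x) * lost_tail t (x - t) \<le> 1 * exp (\<gamma> * t - (exponent t - \<gamma>) * (x - t))"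
    unfolding tilted_tail_exp_split[of x t "exponent t"] by (intro mult_right_mono tail_le) auto
  also have "\<dots> \<le> exp (\<gamma> * t0) * exp (- (rate / 4) * v)"
  proof -
    have "\<gamma> * t \<le> \<gamma> * t0" using t \<gamma>_pos by simp
    with rv have "\<gamma> * t - (exponent t - \<gamma>) * (x - t) \<le> \<gamma> * t0 + - (rate / 4) * v" by linarith
    then show ?thesis by (simp only: mult_1_left exp_add[symmetric] exp_le_cancel_iff)
  qed
  finally have tail: "exp (\<gamma> * x) * lost_tail t (x - t) \<le> exp (\<gamma> * t0) * exp (- (rate / 4) * v)" .
  have "(x powr \<alpha> * f t) * (exp (\<gamma> * x) * lost_tail t (x - t))
      \<le> (2 * A * v powr \<alpha>) * (exp (\<gamma> * t0) * exp (- (rate / 4) * v))"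
    using A_pos f_nonneg[of t] by (intro mult_mono f_le tail mult_nonneg_nonneg lost_tail_nonneg) auto
  then show ?thesis by (simp add: t_def mult_ac)
qed

text \<open>
  The task times are split at \<open>t2\<close>.  Those above it are rescaled and treated by dominated convergence.
  Those below lose less time than a task of length \<open>t2\<close>, whose tail decays at a rate \<open>e2 > \<gamma>\<close>.
\<close>

theorem total_time_limit:
  "((\<lambda>x. x powr (\<alpha> + 1) * exp (\<gamma> * x) * tail_prob M (restart_X T U) (ennreal x))
     \<longlongrightarrow> A * C\<^sub>0 * exp (\<gamma> * t0) * (Gamma (\<alpha> + 1) / rate powr (\<alpha> + 1))) at_top"
proof -
  obtain t2 where t2: "0 < t2" "t2 < t0"
    and bounds: "\<And>t. t2 \<le> t \<Longrightarrow> t < t0 \<Longrightarrow> 0 < tilt_mean \<gamma> t \<and> f t \<le> 2 * A * (t0 - t) powr \<alpha>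
        \<and> \<gamma> + rate / 2 * (t0 - t) \<le> exponent t"
    and unif: "\<And>\<epsilon>. 0 < \<epsilon> \<Longrightarrow> \<exists>z0. \<forall>t z. t2 \<le> t \<and> t < t0 \<and> z0 \<le> z \<longrightarrow>
        \<bar>tilted_tail (exponent t) t z - prefactor t\<bar> \<le> \<epsilon>"
    by (rule edge_window) blast
  define \<phi> where "\<phi> x t = f t * lost_tail t (x - t)" for x t
  have [measurable]: "\<phi> x \<in> borel_measurable borel" for x unfolding \<phi>_def by measurable
  have \<phi>_nonneg: "0 \<le> \<phi> x t" for x t by (simp add: \<phi>_def f_nonneg lost_tail_nonneg)
  have \<phi>_le: "\<phi> x t \<le> f t" for x t
    using mult_left_mono[OF lost_tail_le_1 f_nonneg] by (simp add: \<phi>_def)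
  define I1 where "I1 x = (LINT t|lborel. (if t2 < t \<and> t < t0 then \<phi> x t else 0))" for x
  define I2 where "I2 x = (LINT t|lborel. (if t \<le> t2 then \<phi> x t else 0))" for x
  have int1: "integrable lborel (\<lambda>t. if t2 < t \<and> t < t0 then \<phi> x t else 0)" for x
    by (rule Bochner_Integration.integrable_bound[OF f_integrable])
      (auto intro!: AE_I2 simp: \<phi>_nonneg \<phi>_le f_nonneg)
  have int2: "integrable lborel (\<lambda>t. if t \<le> t2 then \<phi> x t else 0)" for x
    by (rule Bochner_Integration.integrable_bound[OF f_integrable])
      (auto intro!: AE_I2 simp: \<phi>_nonneg \<phi>_le f_nonneg)
  have split: "tail_prob M (restart_X T U) (ennreal x) = I1 x + I2 x" if "0 \<le> x" for x
  proof -
    have "tail_prob M (restart_X T U) (ennreal x) = (LINT t|lborel. \<phi> x t)"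
      unfolding \<phi>_def by (rule total_time_tail[OF that])
    also have "\<dots> = (LINT t|lborel. (if t2 < t \<and> t < t0 then \<phi> x t else 0) + (if t \<le> t2 then \<phi> x t else 0))"
    proof (rule integral_cong_AE)
      show "AE t in lborel. \<phi> x t = (if t2 < t \<and> t < t0 then \<phi> x t else 0) + (if t \<le> t2 then \<phi> x t else 0)"
        using f_beyond AE_lborel_singleton[of t0]
        by eventually_elim (use t2 in \<open>auto simp: \<phi>_def\<close>)
    qed measurable
    also have "\<dots> = I1 x + I2 x"
      unfolding I1_def I2_def by (rule Bochner_Integration.integral_add[OF int1 int2])
    finally show ?thesis .
  qed

  define s where "s x v = (if 0 < v \<and> v < (t0 - t2) * x
    then x powr \<alpha> * exp (\<gamma> * x) * \<phi> x (t0 - v / x) else 0)" for x v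
  let ?F = "\<lambda>v. A * C\<^sub>0 * exp (\<gamma> * t0) * (if 0 < v then v powr \<alpha> * exp (- rate * v) else 0)"
  let ?w = "\<lambda>v. 2 * A * exp (\<gamma> * t0) * (if 0 < v then v powr \<alpha> * exp (- (rate / 4) * v) else 0)"
  have I1_eq: "x powr (\<alpha> + 1) * exp (\<gamma> * x) * I1 x = (LINT v|lborel. s x v)" if x: "0 < x" for x
  proof -
    have "I1 x = \<bar>- 1 / x\<bar> *\<^sub>R (LINT v|lborel.
        (if t2 < t0 + - 1 / x * v \<and> t0 + - 1 / x * v < t0 then \<phi> x (t0 + - 1 / x * v) else 0))"
      unfolding I1_def using x by (intro lborel_integral_real_affine) auto
    then have "x powr (\<alpha> + 1) * exp (\<gamma> * x) * I1 x = x powr \<alpha> * exp (\<gamma> * x) * (LINT v|lborel.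
        (if t2 < t0 + - 1 / x * v \<and> t0 + - 1 / x * v < t0 then \<phi> x (t0 + - 1 / x * v) else 0))"
      using x by (simp add: powr_add)
    also have "\<dots> = (LINT v|lborel. x powr \<alpha> * exp (\<gamma> * x) *
        (if t2 < t0 + - 1 / x * v \<and> t0 + - 1 / x * v < t0 then \<phi> x (t0 + - 1 / x * v) else 0))"
      by simp
    also have "\<dots> = (LINT v|lborel. s x v)"
    proof (intro Bochner_Integration.integral_cong refl)
      fix v
      have "t2 < t0 + - 1 / x * v \<longleftrightarrow> v < (t0 - t2) * x" "t0 + - 1 / x * v < t0 \<longleftrightarrow> 0 < v"
        using x by (auto simp: field_simps)
      then show "x powr \<alpha> * exp (\<gamma> * x) *
        (if t2 < t0 + - 1 / x * v \<and> t0 + - 1 / x * v < t0 then \<phi> x (t0 + - 1 / x * v) else 0) = s x v"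
        by (simp add: s_def)
    qed
    finally show ?thesis .
  qed
  have F: "has_bochner_integral lborel ?F (A * C\<^sub>0 * exp (\<gamma> * t0) * (Gamma (\<alpha> + 1) / rate powr (\<alpha> + 1)))"
    by (intro has_bochner_integral_mult_right has_bochner_integral_Gamma rate_pos)
      (use \<alpha>_nonneg in auto)
  have w: "has_bochner_integral lborel ?w (2 * A * exp (\<gamma> * t0) * (Gamma (\<alpha> + 1) / (rate / 4) powr (\<alpha> + 1)))"
    by (intro has_bochner_integral_mult_right has_bochner_integral_Gamma)
      (use \<alpha>_nonneg rate_pos in auto)
  have "((\<lambda>x. LINT v|lborel. s x v) \<longlongrightarrow> (LINT v|lborel. ?F v)) at_top"
  proof (rule integral_dominated_convergence_at_top)
    show "integrable lborel ?w" using w by (simp add: has_bochner_integral_iff)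
    show "eventually (\<lambda>x. AE v in lborel. norm (s x v) \<le> ?w v) at_top"
      using eventually_ge_at_top[of "2 * t0"]
    proof eventually_elim
      case (elim x)
      show ?case
      proof (rule AE_I2)
        fix v
        have "0 \<le> s x v" by (simp add: s_def \<phi>_nonneg)
        moreover have "s x v \<le> ?w v"
          using scaled_dominated[OF t2 bounds elim, of v] A_pos by (auto simp: s_def \<phi>_def)
        ultimately show "norm (s x v) \<le> ?w v" by simp
      qed
    qed
    show "AE v in lborel. ((\<lambda>x. s x v) \<longlongrightarrow> ?F v) at_top"
    proof (rule AE_I2)
      fix v
      show "((\<lambda>x. s x v) \<longlongrightarrow> ?F v) at_top"
      proof (cases "0 < v")
        case True
        have "eventually (\<lambda>x. x powr \<alpha> * exp (\<gamma> * x) * \<phi> x (t0 - v / x) = s x v) at_top"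
          using eventually_gt_at_top[of "v / (t0 - t2)"]
          by eventually_elim (use True t2 in \<open>auto simp: s_def field_simps\<close>)
        then show ?thesis
          using scaled_pointwise[OF t2(2) unif True] True
          by (auto simp: \<phi>_def elim: Lim_transform_eventually)
      qed (simp add: s_def)
    qed
  qed (auto simp: s_def)
  then have "((\<lambda>x. LINT v|lborel. s x v) \<longlongrightarrow>
      A * C\<^sub>0 * exp (\<gamma> * t0) * (Gamma (\<alpha> + 1) / rate powr (\<alpha> + 1))) at_top"
    using F by (simp add: has_bochner_integral_iff)
  moreover have "eventually (\<lambda>x. (LINT v|lborel. s x v) = x powr (\<alpha> + 1) * exp (\<gamma> * x) * I1 x) at_top"
    using eventually_gt_at_top[of 0] by eventually_elim (rule I1_eq[symmetric])
  ultimately have lim1: "((\<lambda>x. x powr (\<alpha> + 1) * exp (\<gamma> * x) * I1 x) \<longlongrightarrow>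
      A * C\<^sub>0 * exp (\<gamma> * t0) * (Gamma (\<alpha> + 1) / rate powr (\<alpha> + 1))) at_top"
    by (rule Lim_transform_eventually)

  define e2 where "e2 = exponent t2"
  have b2: "0 < tilt_mean \<gamma> t2" "\<gamma> + rate / 2 * (t0 - t2) \<le> e2" using bounds[of t2] t2 by (auto simp: e2_def)
  have e2: "\<gamma> < e2"
  proof -
    have "0 < rate / 2 * (t0 - t2)" using rate_pos t2 by (intro mult_pos_pos) auto
    then show ?thesis using b2 by linarith
  qed
  have e2m: "tilt_mass e2 t2 = 1" unfolding e2_def by (rule exponent) (use t2 b2 in auto)
  have m0: "tilt_mass 0 t2 < 1" using tilt_mass_0_bounds(2)[of t2] t2 tilt_mass_0 by simp
  have I2_le: "I2 x \<le> exp (- e2 * (x - t2))" for x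
  proof -
    have "I2 x \<le> (LINT t|lborel. f t * exp (- e2 * (x - t2)))"
      unfolding I2_def
    proof (intro integral_mono int2 integrable_mult_left f_integrable)
      fix t
      have "lost_tail t (x - t) \<le> exp (- e2 * (x - t2))" if "t \<le> t2"
      proof -
        have "lost_tail t (x - t) \<le> lost_tail t2 (x - t)" by (rule lost_tail_mono[OF that])
        also have "\<dots> \<le> exp (- e2 * (x - t))"
          by (rule lost_tail_le_exp) (use e2 \<gamma>_pos t2 e2m m0 in auto)
        also have "\<dots> \<le> exp (- e2 * (x - t2))" using e2 \<gamma>_pos that by simp
        finally show ?thesis .
      qed
      then show "(if t \<le> t2 then \<phi> x t else 0) \<le> f t * exp (- e2 * (x - t2))"
        using f_nonneg[of t] by (auto simp: \<phi>_def intro!: mult_left_mono)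
    qed
    then show ?thesis by (simp add: f_total)
  qed
  have I2_nonneg: "0 \<le> I2 x" for x
    unfolding I2_def by (intro Bochner_Integration.integral_nonneg) (simp add: \<phi>_nonneg)
  have lim2: "((\<lambda>x. x powr (\<alpha> + 1) * exp (\<gamma> * x) * I2 x) \<longlongrightarrow> 0) at_top"
  proof (rule tendsto_sandwich)
    show "eventually (\<lambda>x. 0 \<le> x powr (\<alpha> + 1) * exp (\<gamma> * x) * I2 x) at_top"
      by (intro always_eventually) (simp add: I2_nonneg)
    show "eventually (\<lambda>x. x powr (\<alpha> + 1) * exp (\<gamma> * x) * I2 x
        \<le> x powr (\<alpha> + 1) * exp (\<gamma> * x) * exp (- e2 * (x - t2))) at_top"
      by (intro always_eventually allI mult_left_mono I2_le) auto
    define \<eta> where "\<eta> = e2 - \<gamma>"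
    have \<eta>: "0 < \<eta>" using e2 by (simp add: \<eta>_def)
    have "((\<lambda>x. x powr (\<alpha> + 1) * exp (- \<eta> * x)) \<longlongrightarrow> 0) at_top"
      using \<eta> by real_asymp
    then have "((\<lambda>x. exp (e2 * t2) * (x powr (\<alpha> + 1) * exp (- \<eta> * x))) \<longlongrightarrow> exp (e2 * t2) * 0) at_top"
      by (intro tendsto_mult tendsto_const)
    moreover have "exp (e2 * t2) * (x powr (\<alpha> + 1) * exp (- \<eta> * x))
        = x powr (\<alpha> + 1) * exp (\<gamma> * x) * exp (- e2 * (x - t2))" for x
    proof -
      have "exp (e2 * t2) * exp (- \<eta> * x) = exp (\<gamma> * x) * exp (- e2 * (x - t2))"
        by (simp add: exp_add[symmetric] \<eta>_def algebra_simps)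
      then show ?thesis by (simp only: mult.left_commute[of "exp (e2 * t2)"] mult.assoc)
    qed
    ultimately show "((\<lambda>x. x powr (\<alpha> + 1) * exp (\<gamma> * x) * exp (- e2 * (x - t2))) \<longlongrightarrow> 0) at_top"
      by (simp only: mult_zero_right)
  qed auto
  have "((\<lambda>x. x powr (\<alpha> + 1) * exp (\<gamma> * x) * I1 x + x powr (\<alpha> + 1) * exp (\<gamma> * x) * I2 x) \<longlongrightarrow>
      A * C\<^sub>0 * exp (\<gamma> * t0) * (Gamma (\<alpha> + 1) / rate powr (\<alpha> + 1)) + 0) at_top"
    by (rule tendsto_add[OF lim1 lim2])
  moreover have "eventually (\<lambda>x. x powr (\<alpha> + 1) * exp (\<gamma> * x) * I1 x + x powr (\<alpha> + 1) * exp (\<gamma> * x) * I2 x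
     = x powr (\<alpha> + 1) * exp (\<gamma> * x) * tail_prob M (restart_X T U) (ennreal x)) at_top"
    using eventually_ge_at_top[of 0] by eventually_elim (simp add: split distrib_left)
  ultimately show ?thesis
    by (auto elim: Lim_transform_eventually)
qed

end

theorem proposition3p2:
  fixes M :: "'a measure" and T :: "'a \<Rightarrow> real" and U :: "nat \<Rightarrow> 'a \<Rightarrow> real"
    and f g :: "real \<Rightarrow> real" and t0 A \<alpha> \<gamma> B :: real
  assumes model: "restart_model M T U f g"
    and t0_pos: "0 < t0"
    and endpoint: "upper_endpoint (distr M borel T) = ereal t0"
    and G_tail: "tail_prob M (U 0) t0 > 0"
    and A_pos: "0 < A" and \<alpha>_nonneg: "0 \<le> \<alpha>"
    and f_asymp: "f \<sim>[at_left t0] (\<lambda>t. A * (t0 - t) powr \<alpha>)"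
    and g_left_cont: "continuous (at_left t0) g"
    and g_pos: "g t0 > 0"
    and \<gamma>_pos: "0 < \<gamma>"
    and \<gamma>_eq: "(LINT y:{0..t0}|lborel. exp (\<gamma> * y) * g y) = 1"
    and B_eq: "B = (LINT y:{0..t0}|lborel. y * exp (\<gamma> * y) * g y)"
  shows "(\<lambda>x::real. tail_prob M (restart_X T U) (ennreal x)) \<sim>[at_top]
           (\<lambda>x. (A * B powr \<alpha> * tail_prob M (U 0) t0 * Gamma (\<alpha> + 1))
                  / (\<gamma> * exp (\<alpha> * \<gamma> * t0) * g t0 powr (\<alpha> + 1))
                  * (exp (- \<gamma> * x) / x powr (\<alpha> + 1)))"
proof -
  interpret restart_model M T U f g by (rule model)
  have mass: "tilt_mass \<gamma> t0 = 1"
    unfolding \<gamma>_eq[symmetric] tilt_mass_def set_lebesgue_integral_def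
    by (intro Bochner_Integration.integral_cong) (auto simp: tilt_def indicator_def)
  have mean: "tilt_mean \<gamma> t0 = B"
    unfolding B_eq tilt_mean_def set_lebesgue_integral_def
    by (intro Bochner_Integration.integral_cong) (auto simp: tilt_def indicator_def)
  have tail: "tail_prob M (U 0) t0 = 1 - tilt_mass 0 t0"
    unfolding tilt_mass_def tilt_def using tail_prob_U[of t0 0] t0_pos
    by (simp only: mult_zero_left exp_zero mult_1_left less_imp_le)
  have "AE t in density lborel (\<lambda>t. ennreal (f t)). t \<le> t0"
    using AE_le_upper_endpoint[OF sets_distr endpoint] unfolding distr_T .
  then have "AE t in lborel. 0 < ennreal (f t) \<longrightarrow> t \<le> t0"
    by (subst (asm) AE_density) auto
  then have beyond: "AE t in lborel. t0 < t \<longrightarrow> f t = 0"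
    by eventually_elim (use f_nonneg in \<open>auto simp: less_le\<close>)
  have f_edge: "((\<lambda>t. f t / (t0 - t) powr \<alpha>) \<longlongrightarrow> A) (at_left t0)"
  proof -
    have "((\<lambda>t. A * (if f t = 0 \<and> A * (t0 - t) powr \<alpha> = 0 then 1 else f t / (A * (t0 - t) powr \<alpha>)))
        \<longlongrightarrow> A * 1) (at_left t0)"
      using f_asymp unfolding asymp_equiv_def by (intro tendsto_intros)
    moreover have "eventually (\<lambda>t. t < t0) (at_left t0)"
      by (simp add: eventually_at_filter)
    then have "eventually (\<lambda>t. A * (if f t = 0 \<and> A * (t0 - t) powr \<alpha> = 0 then 1 else f t / (A * (t0 - t) powr \<alpha>))
        = f t / (t0 - t) powr \<alpha>) (at_left t0)"
      by eventually_elim (use A_pos in auto)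
    ultimately show ?thesis by (auto elim: Lim_transform_eventually)
  qed
  interpret restart_edge M T U f g t0 \<gamma> A \<alpha>
  proof
    show "tilt_mass 0 t0 < 1" using G_tail tail by simp
    show "(g \<longlongrightarrow> g t0) (at_left t0)" using g_left_cont by (simp add: continuous_within)
  qed (fact t0_pos \<gamma>_pos mass g_pos A_pos \<alpha>_nonneg f_edge beyond)+
  define K where "K = (A * B powr \<alpha> * tail_prob M (U 0) t0 * Gamma (\<alpha> + 1))
      / (\<gamma> * exp (\<alpha> * \<gamma> * t0) * g t0 powr (\<alpha> + 1))"
  have B: "0 < B" using B_pos by (simp add: mean)
  have K_eq: "A * C\<^sub>0 * exp (\<gamma> * t0) * (Gamma (\<alpha> + 1) / rate powr (\<alpha> + 1)) = K"
  proof -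
    \<comment> \<open>The last factor cancels \<open>e\<^bsup>\<gamma> t0\<^esup>\<close> in the limit, which stems from the shift of \<open>x\<close> by the task time.\<close>
    have "exp (\<gamma> * t0) powr (\<alpha> + 1) = exp (\<alpha> * \<gamma> * t0) * exp (\<gamma> * t0)"
      by (simp add: powr_def exp_add[symmetric] algebra_simps)
    then have R: "rate powr (\<alpha> + 1) = exp (\<alpha> * \<gamma> * t0) * exp (\<gamma> * t0) * g t0 powr (\<alpha> + 1) / (B powr \<alpha> * B)"
      using B g_pos by (simp add: mean powr_divide powr_mult powr_add)
    show ?thesis
      unfolding R K_def tail using B \<gamma>_pos g_pos by (simp add: mean field_simps)
  qed
  have "0 < K"
    unfolding K_def using A_pos B G_tail \<gamma>_pos g_pos \<alpha>_nonneg Gamma_real_pos[of "\<alpha> + 1"]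
    by (intro divide_pos_pos mult_pos_pos) auto
  have "((\<lambda>x. x powr (\<alpha> + 1) * exp (\<gamma> * x) * tail_prob M (restart_X T U) (ennreal x) / K) \<longlongrightarrow> K / K) at_top"
    using \<open>0 < K\<close> total_time_limit unfolding K_eq by (intro tendsto_intros) auto
  moreover have "eventually (\<lambda>x. x powr (\<alpha> + 1) * exp (\<gamma> * x) * tail_prob M (restart_X T U) (ennreal x) / K
      = tail_prob M (restart_X T U) (ennreal x) / (K * (exp (- \<gamma> * x) / x powr (\<alpha> + 1)))) at_top"
    using eventually_gt_at_top[of 0]
    by eventually_elim (use \<open>0 < K\<close> in \<open>simp add: exp_minus field_simps\<close>)
  ultimately have "((\<lambda>x. tail_prob M (restart_X T U) (ennreal x) / (K * (exp (- \<gamma> * x) / x powr (\<alpha> + 1)))) \<longlongrightarrow> 1) at_top"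
    using \<open>0 < K\<close> by (auto elim: Lim_transform_eventually)
  then show ?thesis
    unfolding K_def[symmetric] by (rule asymp_equivI')
qed

end
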